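(* Let $\mathcal{A}$, $\mathcal{X}$, $\mathcal{Y}$ be abelian categories with a recollement of $\mathcal{A}$ by $\mathcal{Y}$ and $\mathcal{X}$, and suppose that $\mathcal{A}$ has a generator. Then both $\mathcal{X}$ and $\mathcal{Y}$ have a generator. Moreover, if $\mathcal{A}$ is a Grothendieck category, then so are $\mathcal{X}$ and $\mathcal{Y}$.
   Context: Standing assumption: in every abelian category considered, $\mathrm{Ext}^1(X,Y)$ (Yoneda extensions) is a set for all objects $X,Y$. A recollement of an abelian category $\mathcal{A}$ by abelian categories $\mathcal{Y}$ and $\mathcal{X}$ consists of additive functors $i_*:\mathcal{Y}\to\mathcal{A}$, $i^*,i^!:\mathcal{A}\to\mathcal{Y}$, $j^*:\mathcal{A}\to\mathcal{X}$, $j_!,j_*:\mathcal{X}\to\mathcal{A}$ such that (i) $i^*\dashv i_*\dashv i^!$ and $j_!\dashv j^*\dashv j_*$; (ii) $i_*,j_!,j_*$ are fully faithful; (iii) $\mathrm{Im}(i_* )=\mathrm{Ker}(j^* )$ (essential image). A generator is an object $G$ such that $\mathrm{Hom}(G,\phi)\neq0$ for every nonzero morphism $\phi$. Grothendieck: set-indexed coproducts exist, direct limits over directed sets are exact, and there is a generator. *)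

theory Defs
  imports "HOL-Algebra.Group"
begin

unbundle cardinal_syntax

text \<open>
  Size conventions. A cardinal \<open>\<kappa>\<close> plays the role of the universe: ``set'' (or ``small'') means
  ``of cardinality less than \<open>\<kappa>\<close>'', while the objects of a category may form an arbitrary
  collection. For \<open>\<kappa>\<close> strongly inaccessible these are the small sets of a Grothendieck universe.
  The definitions make sense for every infinite cardinal, and inaccessibility is never imposed.
\<close>

definition small :: "'k rel \<Rightarrow> 'a set \<Rightarrow> bool" where
  "small \<kappa> S \<longleftrightarrow> |S| <o \<kappa>"


section \<open>Categories\<close>

record ('o, 'm) category_data =
  Ob :: "'o set"
  Ar :: "'m set"
  Dom :: "'m \<Rightarrow> 'o"
  Cod :: "'m \<Rightarrow> 'o"
  Idn :: "'o \<Rightarrow> 'm"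
  Cmp :: "'m \<Rightarrow> 'm \<Rightarrow> 'm"  (infixl "\<cdot>\<index>" 70)

definition Hom :: "('o, 'm, 'z) category_data_scheme \<Rightarrow> 'o \<Rightarrow> 'o \<Rightarrow> 'm set" where
  "Hom C X Y = {f \<in> Ar C. Dom C f = X \<and> Cod C f = Y}"

locale category =
  fixes C (structure)
  assumes Dom_in_Ob: "f \<in> Ar C \<Longrightarrow> Dom C f \<in> Ob C"
    and Cod_in_Ob: "f \<in> Ar C \<Longrightarrow> Cod C f \<in> Ob C"
    and Idn_in_Hom: "X \<in> Ob C \<Longrightarrow> Idn C X \<in> Hom C X X"
    and Cmp_in_Hom: "\<lbrakk>f \<in> Hom C X Y; g \<in> Hom C Y Z\<rbrakk> \<Longrightarrow> g \<cdot> f \<in> Hom C X Z"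
    and Cmp_Idn_left: "f \<in> Hom C X Y \<Longrightarrow> Idn C Y \<cdot> f = f"
    and Cmp_Idn_right: "f \<in> Hom C X Y \<Longrightarrow> f \<cdot> Idn C X = f"
    and Cmp_assoc: "\<lbrakk>f \<in> Hom C W X; g \<in> Hom C X Y; h \<in> Hom C Y Z\<rbrakk>
                      \<Longrightarrow> (h \<cdot> g) \<cdot> f = h \<cdot> (g \<cdot> f)"

definition locally_small :: "'k rel \<Rightarrow> ('o, 'm, 'z) category_data_scheme \<Rightarrow> bool" where
  "locally_small \<kappa> C \<longleftrightarrow> (\<forall>X\<in>Ob C. \<forall>Y\<in>Ob C. small \<kappa> (Hom C X Y))"

definition isomorphic :: "('o, 'm, 'z) category_data_scheme \<Rightarrow> 'o \<Rightarrow> 'o \<Rightarrow> bool" where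
  "isomorphic C X Y \<longleftrightarrow>
     (\<exists>f\<in>Hom C X Y. \<exists>g\<in>Hom C Y X. g \<cdot>\<^bsub>C\<^esub> f = Idn C X \<and> f \<cdot>\<^bsub>C\<^esub> g = Idn C Y)"

definition monomorphism :: "('o, 'm, 'z) category_data_scheme \<Rightarrow> 'm \<Rightarrow> bool" where
  "monomorphism C f \<longleftrightarrow> f \<in> Ar C \<and>
     (\<forall>W\<in>Ob C. \<forall>g\<in>Hom C W (Dom C f). \<forall>h\<in>Hom C W (Dom C f).
        f \<cdot>\<^bsub>C\<^esub> g = f \<cdot>\<^bsub>C\<^esub> h \<longrightarrow> g = h)"

definition epimorphism :: "('o, 'm, 'z) category_data_scheme \<Rightarrow> 'm \<Rightarrow> bool" where
  "epimorphism C f \<longleftrightarrow> f \<in> Ar C \<and>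
     (\<forall>Z\<in>Ob C. \<forall>g\<in>Hom C (Cod C f) Z. \<forall>h\<in>Hom C (Cod C f) Z.
        g \<cdot>\<^bsub>C\<^esub> f = h \<cdot>\<^bsub>C\<^esub> f \<longrightarrow> g = h)"

definition zero_object :: "('o, 'm, 'z) category_data_scheme \<Rightarrow> 'o \<Rightarrow> bool" where
  "zero_object C Z \<longleftrightarrow> Z \<in> Ob C \<and>
     (\<forall>X\<in>Ob C. (\<exists>!f. f \<in> Hom C X Z) \<and> (\<exists>!f. f \<in> Hom C Z X))"


section \<open>Abelian categories\<close>

record ('o, 'm) preadditive_data = "('o, 'm) category_data" +
  Add :: "'m \<Rightarrow> 'm \<Rightarrow> 'm"
  Zer :: "'o \<Rightarrow> 'o \<Rightarrow> 'm"

definition Hom_group ::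
  "('o, 'm, 'z) preadditive_data_scheme \<Rightarrow> 'o \<Rightarrow> 'o \<Rightarrow> 'm monoid" where
  "Hom_group C X Y = \<lparr>carrier = Hom C X Y, mult = Add C, one = Zer C X Y\<rparr>"

locale preadditive_category = category +
  assumes Hom_comm_group: "\<lbrakk>X \<in> Ob C; Y \<in> Ob C\<rbrakk> \<Longrightarrow> comm_group (Hom_group C X Y)"
    and Cmp_Add_left: "\<lbrakk>f \<in> Hom C X Y; g \<in> Hom C Y Z; g' \<in> Hom C Y Z\<rbrakk>
                         \<Longrightarrow> Add C g g' \<cdot> f = Add C (g \<cdot> f) (g' \<cdot> f)"
    and Cmp_Add_right: "\<lbrakk>f \<in> Hom C X Y; f' \<in> Hom C X Y; g \<in> Hom C Y Z\<rbrakk>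
                         \<Longrightarrow> g \<cdot> Add C f f' = Add C (g \<cdot> f) (g \<cdot> f')"

definition is_biproduct ::
  "('o, 'm, 'z) preadditive_data_scheme \<Rightarrow> 'o \<Rightarrow> 'o \<Rightarrow> 'o \<Rightarrow> 'm \<Rightarrow> 'm \<Rightarrow> 'm \<Rightarrow> 'm \<Rightarrow> bool"
where
  "is_biproduct C X Y B i1 i2 p1 p2 \<longleftrightarrow>
     B \<in> Ob C \<and> i1 \<in> Hom C X B \<and> i2 \<in> Hom C Y B \<and> p1 \<in> Hom C B X \<and> p2 \<in> Hom C B Y \<and>
     p1 \<cdot>\<^bsub>C\<^esub> i1 = Idn C X \<and> p2 \<cdot>\<^bsub>C\<^esub> i2 = Idn C Y \<and>
     p2 \<cdot>\<^bsub>C\<^esub> i1 = Zer C X Y \<and> p1 \<cdot>\<^bsub>C\<^esub> i2 = Zer C Y X \<and>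
     Add C (i1 \<cdot>\<^bsub>C\<^esub> p1) (i2 \<cdot>\<^bsub>C\<^esub> p2) = Idn C B"

definition is_kernel :: "('o, 'm, 'z) preadditive_data_scheme \<Rightarrow> 'm \<Rightarrow> 'm \<Rightarrow> bool" where
  "is_kernel C k f \<longleftrightarrow>
     k \<in> Ar C \<and> f \<in> Ar C \<and> Cod C k = Dom C f \<and>
     f \<cdot>\<^bsub>C\<^esub> k = Zer C (Dom C k) (Cod C f) \<and>
     (\<forall>W\<in>Ob C. \<forall>h\<in>Hom C W (Dom C f). f \<cdot>\<^bsub>C\<^esub> h = Zer C W (Cod C f) \<longrightarrow>
        (\<exists>!u. u \<in> Hom C W (Dom C k) \<and> k \<cdot>\<^bsub>C\<^esub> u = h))"

definition is_cokernel :: "('o, 'm, 'z) preadditive_data_scheme \<Rightarrow> 'm \<Rightarrow> 'm \<Rightarrow> bool" where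
  "is_cokernel C c f \<longleftrightarrow>
     c \<in> Ar C \<and> f \<in> Ar C \<and> Dom C c = Cod C f \<and>
     c \<cdot>\<^bsub>C\<^esub> f = Zer C (Dom C f) (Cod C c) \<and>
     (\<forall>Z\<in>Ob C. \<forall>h\<in>Hom C (Cod C f) Z. h \<cdot>\<^bsub>C\<^esub> f = Zer C (Dom C f) Z \<longrightarrow>
        (\<exists>!u. u \<in> Hom C (Cod C c) Z \<and> u \<cdot>\<^bsub>C\<^esub> c = h))"

locale abelian_category = preadditive_category +
  assumes ex_zero_object: "\<exists>Z. zero_object C Z"
    and ex_biproduct: "\<lbrakk>X \<in> Ob C; Y \<in> Ob C\<rbrakk> \<Longrightarrow> \<exists>B i1 i2 p1 p2. is_biproduct C X Y B i1 i2 p1 p2"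
    and ex_kernel: "f \<in> Ar C \<Longrightarrow> \<exists>k. is_kernel C k f"
    and ex_cokernel: "f \<in> Ar C \<Longrightarrow> \<exists>c. is_cokernel C c f"
    and mono_is_kernel: "monomorphism C f \<Longrightarrow> \<exists>g. is_kernel C f g"
    and epi_is_cokernel: "epimorphism C f \<Longrightarrow> \<exists>g. is_cokernel C f g"

text \<open>Exactness of \<open>0 \<rightarrow> Dom f \<rightarrow> Cod f = Dom g \<rightarrow> Cod g \<rightarrow> 0\<close>.\<close>

definition short_exact :: "('o, 'm, 'z) preadditive_data_scheme \<Rightarrow> 'm \<Rightarrow> 'm \<Rightarrow> bool" where
  "short_exact C f g \<longleftrightarrow> is_kernel C f g \<and> is_cokernel C g f"


subsection \<open>Yoneda extensions\<close>

definition extensions ::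
  "('o, 'm, 'z) preadditive_data_scheme \<Rightarrow> 'o \<Rightarrow> 'o \<Rightarrow> ('m \<times> 'm) set" where
  "extensions C X Y =
     {(f, g). \<exists>E\<in>Ob C. f \<in> Hom C Y E \<and> g \<in> Hom C E X \<and> short_exact C f g}"

text \<open>The comparison map \<open>h\<close> below is automatically an isomorphism, by the five lemma.\<close>

definition extension_rel ::
  "('o, 'm, 'z) preadditive_data_scheme \<Rightarrow> 'o \<Rightarrow> 'o \<Rightarrow> ('m \<times> 'm) rel" where
  "extension_rel C X Y =
     {((f, g), (f', g')). (f, g) \<in> extensions C X Y \<and> (f', g') \<in> extensions C X Y \<and>
        (\<exists>h\<in>Hom C (Cod C f) (Cod C f'). h \<cdot>\<^bsub>C\<^esub> f = f' \<and> g' \<cdot>\<^bsub>C\<^esub> h = g)}"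

definition Ext1 ::
  "('o, 'm, 'z) preadditive_data_scheme \<Rightarrow> 'o \<Rightarrow> 'o \<Rightarrow> ('m \<times> 'm) set set" where
  "Ext1 C X Y = extensions C X Y // extension_rel C X Y"

definition Ext1_small :: "'k rel \<Rightarrow> ('o, 'm, 'z) preadditive_data_scheme \<Rightarrow> bool" where
  "Ext1_small \<kappa> C \<longleftrightarrow> (\<forall>X\<in>Ob C. \<forall>Y\<in>Ob C. small \<kappa> (Ext1 C X Y))"


section \<open>Functors, adjunctions and recollements\<close>

record ('o, 'm, 'p, 'n) functor_data =
  FOb :: "'o \<Rightarrow> 'p"
  FAr :: "'m \<Rightarrow> 'n"

locale additive_functor =
  fixes C :: "('o, 'm, 'y) preadditive_data_scheme"
    and D :: "('p, 'n, 'z) preadditive_data_scheme"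
    and F :: "('o, 'm, 'p, 'n) functor_data"
  assumes FOb_in_Ob: "X \<in> Ob C \<Longrightarrow> FOb F X \<in> Ob D"
    and FAr_in_Hom: "f \<in> Hom C X Y \<Longrightarrow> FAr F f \<in> Hom D (FOb F X) (FOb F Y)"
    and FAr_Idn: "X \<in> Ob C \<Longrightarrow> FAr F (Idn C X) = Idn D (FOb F X)"
    and FAr_Cmp: "\<lbrakk>f \<in> Hom C X Y; g \<in> Hom C Y Z\<rbrakk> \<Longrightarrow> FAr F (g \<cdot>\<^bsub>C\<^esub> f) = FAr F g \<cdot>\<^bsub>D\<^esub> FAr F f"
    and FAr_Add: "\<lbrakk>f \<in> Hom C X Y; g \<in> Hom C X Y\<rbrakk> \<Longrightarrow> FAr F (Add C f g) = Add D (FAr F f) (FAr F g)"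

definition fully_faithful ::
  "('o, 'm, 'y) category_data_scheme \<Rightarrow> ('p, 'n, 'z) category_data_scheme
     \<Rightarrow> ('o, 'm, 'p, 'n) functor_data \<Rightarrow> bool" where
  "fully_faithful C D F \<longleftrightarrow>
     (\<forall>X\<in>Ob C. \<forall>Y\<in>Ob C. bij_betw (FAr F) (Hom C X Y) (Hom D (FOb F X) (FOb F Y)))"

text \<open>\<open>adjunction C D F G\<close>: the functor \<open>F : C \<rightarrow> D\<close> is left adjoint to \<open>G : D \<rightarrow> C\<close>.\<close>

definition adjunction ::
  "('o, 'm, 'y) category_data_scheme \<Rightarrow> ('p, 'n, 'z) category_data_scheme
     \<Rightarrow> ('o, 'm, 'p, 'n) functor_data \<Rightarrow> ('p, 'n, 'o, 'm) functor_data \<Rightarrow> bool" where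
  "adjunction C D F G \<longleftrightarrow>
     (\<exists>\<phi>. (\<forall>X\<in>Ob C. \<forall>Y\<in>Ob D. bij_betw (\<phi> X Y) (Hom D (FOb F X) Y) (Hom C X (FOb G Y))) \<and>
          (\<forall>X\<in>Ob C. \<forall>X'\<in>Ob C. \<forall>Y\<in>Ob D. \<forall>Y'\<in>Ob D.
             \<forall>f\<in>Hom C X' X. \<forall>g\<in>Hom D Y Y'. \<forall>h\<in>Hom D (FOb F X) Y.
               \<phi> X' Y' (g \<cdot>\<^bsub>D\<^esub> h \<cdot>\<^bsub>D\<^esub> FAr F f) = FAr G g \<cdot>\<^bsub>C\<^esub> \<phi> X Y h \<cdot>\<^bsub>C\<^esub> f))"

definition essential_image ::
  "('o, 'm, 'y) category_data_scheme \<Rightarrow> ('p, 'n, 'z) category_data_scheme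
     \<Rightarrow> ('o, 'm, 'p, 'n) functor_data \<Rightarrow> 'p set" where
  "essential_image C D F = {B \<in> Ob D. \<exists>X\<in>Ob C. isomorphic D (FOb F X) B}"

definition functor_kernel ::
  "('o, 'm, 'y) category_data_scheme \<Rightarrow> ('p, 'n, 'z) category_data_scheme
     \<Rightarrow> ('o, 'm, 'p, 'n) functor_data \<Rightarrow> 'o set" where
  "functor_kernel C D F = {X \<in> Ob C. zero_object D (FOb F X)}"

text \<open>
  A recollement of \<open>A\<close> by \<open>Y\<close> and \<open>X\<close>. The six functors are, in this order,
  \<open>i\<^sub>* : Y \<rightarrow> A\<close>, \<open>i\<^sup>* : A \<rightarrow> Y\<close>, \<open>i\<^sup>! : A \<rightarrow> Y\<close>, \<open>j\<^sup>* : A \<rightarrow> X\<close>, \<open>j\<^sub>! : X \<rightarrow> A\<close>, \<open>j\<^sub>* : X \<rightarrow> A\<close>.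
\<close>

locale recollement =
  fixes A :: "('a, 'am, 'az) preadditive_data_scheme"
    and Y :: "('y, 'ym, 'yz) preadditive_data_scheme"
    and X :: "('x, 'xm, 'xz) preadditive_data_scheme"
    and i_lower_star :: "('y, 'ym, 'a, 'am) functor_data"
    and i_upper_star :: "('a, 'am, 'y, 'ym) functor_data"
    and i_upper_shriek :: "('a, 'am, 'y, 'ym) functor_data"
    and j_upper_star :: "('a, 'am, 'x, 'xm) functor_data"
    and j_lower_shriek :: "('x, 'xm, 'a, 'am) functor_data"
    and j_lower_star :: "('x, 'xm, 'a, 'am) functor_data"
  assumes i_lower_star_additive: "additive_functor Y A i_lower_star"
    and i_upper_star_additive: "additive_functor A Y i_upper_star"
    and i_upper_shriek_additive: "additive_functor A Y i_upper_shriek"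
    and j_upper_star_additive: "additive_functor A X j_upper_star"
    and j_lower_shriek_additive: "additive_functor X A j_lower_shriek"
    and j_lower_star_additive: "additive_functor X A j_lower_star"
    and i_upper_star_adjunction: "adjunction A Y i_upper_star i_lower_star"
    and i_upper_shriek_adjunction: "adjunction Y A i_lower_star i_upper_shriek"
    and j_lower_shriek_adjunction: "adjunction X A j_lower_shriek j_upper_star"
    and j_lower_star_adjunction: "adjunction A X j_upper_star j_lower_star"
    and i_lower_star_fully_faithful: "fully_faithful Y A i_lower_star"
    and j_lower_shriek_fully_faithful: "fully_faithful X A j_lower_shriek"
    and j_lower_star_fully_faithful: "fully_faithful X A j_lower_star"
    and image_eq_kernel: "essential_image Y A i_lower_star = functor_kernel A X j_upper_star"


section \<open>Generators and Grothendieck categories\<close>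

text \<open>The last clause says that the map \<open>Hom(G, \<phi>) = (h \<mapsto> \<phi> h)\<close> is not the zero map.\<close>

definition is_generator :: "('o, 'm, 'z) preadditive_data_scheme \<Rightarrow> 'o \<Rightarrow> bool" where
  "is_generator C G \<longleftrightarrow> G \<in> Ob C \<and>
     (\<forall>X\<in>Ob C. \<forall>Y\<in>Ob C. \<forall>\<phi>\<in>Hom C X Y. \<phi> \<noteq> Zer C X Y \<longrightarrow>
        (\<exists>h\<in>Hom C G X. \<phi> \<cdot>\<^bsub>C\<^esub> h \<noteq> Zer C G Y))"

definition has_generator :: "('o, 'm, 'z) preadditive_data_scheme \<Rightarrow> bool" where
  "has_generator C \<longleftrightarrow> (\<exists>G. is_generator C G)"

definition is_coproduct ::
  "('o, 'm, 'z) category_data_scheme \<Rightarrow> 'i set \<Rightarrow> ('i \<Rightarrow> 'o) \<Rightarrow> 'o \<Rightarrow> ('i \<Rightarrow> 'm) \<Rightarrow> bool" where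
  "is_coproduct C I X P \<iota> \<longleftrightarrow>
     P \<in> Ob C \<and> (\<forall>i\<in>I. \<iota> i \<in> Hom C (X i) P) \<and>
     (\<forall>Z\<in>Ob C. \<forall>f. (\<forall>i\<in>I. f i \<in> Hom C (X i) Z) \<longrightarrow>
        (\<exists>!u. u \<in> Hom C P Z \<and> (\<forall>i\<in>I. u \<cdot>\<^bsub>C\<^esub> \<iota> i = f i)))"

text \<open>
  Index sets are taken inside the type underlying \<open>\<kappa>\<close>. This is no restriction: every small set,
  of whatever type, is in bijection with a small subset of that type.
\<close>

definition has_small_coproducts :: "'k rel \<Rightarrow> ('o, 'm, 'z) category_data_scheme \<Rightarrow> bool" where
  "has_small_coproducts \<kappa> C \<longleftrightarrow>
     (\<forall>(I :: 'k set) X. small \<kappa> I \<and> (\<forall>i\<in>I. X i \<in> Ob C) \<longrightarrow> (\<exists>P \<iota>. is_coproduct C I X P \<iota>))"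

definition directed_set :: "'i set \<Rightarrow> 'i rel \<Rightarrow> bool" where
  "directed_set I r \<longleftrightarrow>
     preorder_on I r \<and> I \<noteq> {} \<and> (\<forall>i\<in>I. \<forall>j\<in>I. \<exists>k\<in>I. (i, k) \<in> r \<and> (j, k) \<in> r)"

definition direct_system ::
  "('o, 'm, 'z) category_data_scheme \<Rightarrow> 'i set \<Rightarrow> 'i rel \<Rightarrow> ('i \<Rightarrow> 'o) \<Rightarrow> ('i \<Rightarrow> 'i \<Rightarrow> 'm) \<Rightarrow> bool"
where
  "direct_system C I r X t \<longleftrightarrow>
     (\<forall>i\<in>I. X i \<in> Ob C \<and> t i i = Idn C (X i)) \<and>
     (\<forall>i j. (i, j) \<in> r \<longrightarrow> t i j \<in> Hom C (X i) (X j)) \<and>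
     (\<forall>i j k. (i, j) \<in> r \<longrightarrow> (j, k) \<in> r \<longrightarrow> t j k \<cdot>\<^bsub>C\<^esub> t i j = t i k)"

definition direct_system_map ::
  "('o, 'm, 'z) category_data_scheme \<Rightarrow> 'i set \<Rightarrow> 'i rel
     \<Rightarrow> ('i \<Rightarrow> 'o) \<Rightarrow> ('i \<Rightarrow> 'i \<Rightarrow> 'm) \<Rightarrow> ('i \<Rightarrow> 'o) \<Rightarrow> ('i \<Rightarrow> 'i \<Rightarrow> 'm) \<Rightarrow> ('i \<Rightarrow> 'm) \<Rightarrow> bool" where
  "direct_system_map C I r X t X' t' f \<longleftrightarrow>
     (\<forall>i\<in>I. f i \<in> Hom C (X i) (X' i)) \<and>
     (\<forall>i j. (i, j) \<in> r \<longrightarrow> f j \<cdot>\<^bsub>C\<^esub> t i j = t' i j \<cdot>\<^bsub>C\<^esub> f i)"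

definition is_cocone ::
  "('o, 'm, 'z) category_data_scheme \<Rightarrow> 'i set \<Rightarrow> 'i rel
     \<Rightarrow> ('i \<Rightarrow> 'o) \<Rightarrow> ('i \<Rightarrow> 'i \<Rightarrow> 'm) \<Rightarrow> 'o \<Rightarrow> ('i \<Rightarrow> 'm) \<Rightarrow> bool" where
  "is_cocone C I r X t Z a \<longleftrightarrow>
     Z \<in> Ob C \<and> (\<forall>i\<in>I. a i \<in> Hom C (X i) Z) \<and> (\<forall>i j. (i, j) \<in> r \<longrightarrow> a j \<cdot>\<^bsub>C\<^esub> t i j = a i)"

definition is_direct_limit ::
  "('o, 'm, 'z) category_data_scheme \<Rightarrow> 'i set \<Rightarrow> 'i rel
     \<Rightarrow> ('i \<Rightarrow> 'o) \<Rightarrow> ('i \<Rightarrow> 'i \<Rightarrow> 'm) \<Rightarrow> 'o \<Rightarrow> ('i \<Rightarrow> 'm) \<Rightarrow> bool" where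
  "is_direct_limit C I r X t L a \<longleftrightarrow>
     is_cocone C I r X t L a \<and>
     (\<forall>Z b. is_cocone C I r X t Z b \<longrightarrow>
        (\<exists>!u. u \<in> Hom C L Z \<and> (\<forall>i\<in>I. u \<cdot>\<^bsub>C\<^esub> a i = b i)))"

text \<open>
  Direct limits over small directed sets exist and, as functors on direct systems, are exact:
  a sequence of direct systems that is short exact at each index induces a short exact sequence
  \<open>0 \<rightarrow> L \<rightarrow> L' \<rightarrow> L'' \<rightarrow> 0\<close> of limits, whose maps \<open>u\<close>, \<open>v\<close> are determined by the compatibility
  conditions.
\<close>

definition has_exact_direct_limits :: "'k rel \<Rightarrow> ('o, 'm, 'z) preadditive_data_scheme \<Rightarrow> bool" where
  "has_exact_direct_limits \<kappa> C \<longleftrightarrow>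
     (\<forall>(I :: 'k set) r. small \<kappa> I \<and> directed_set I r \<longrightarrow>
        (\<forall>X t. direct_system C I r X t \<longrightarrow> (\<exists>L a. is_direct_limit C I r X t L a)) \<and>
        (\<forall>X t X' t' X'' t'' f g L a L' a' L'' a'' u v.
           direct_system C I r X t \<and> direct_system C I r X' t' \<and> direct_system C I r X'' t'' \<and>
           direct_system_map C I r X t X' t' f \<and> direct_system_map C I r X' t' X'' t'' g \<and>
           (\<forall>i\<in>I. short_exact C (f i) (g i)) \<and>
           is_direct_limit C I r X t L a \<and> is_direct_limit C I r X' t' L' a' \<and>
           is_direct_limit C I r X'' t'' L'' a'' \<and>
           u \<in> Hom C L L' \<and> (\<forall>i\<in>I. u \<cdot>\<^bsub>C\<^esub> a i = a' i \<cdot>\<^bsub>C\<^esub> f i) \<and>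
           v \<in> Hom C L' L'' \<and> (\<forall>i\<in>I. v \<cdot>\<^bsub>C\<^esub> a' i = a'' i \<cdot>\<^bsub>C\<^esub> g i)
           \<longrightarrow> short_exact C u v))"

definition grothendieck_category :: "'k rel \<Rightarrow> ('o, 'm, 'z) preadditive_data_scheme \<Rightarrow> bool" where
  "grothendieck_category \<kappa> C \<longleftrightarrow>
     abelian_category C \<and> has_small_coproducts \<kappa> C \<and> has_exact_direct_limits \<kappa> C \<and> has_generator C"

end

theory Submission
  imports Defs
begin

text \<open>
  Both \<open>X\<close> and \<open>Y\<close> are reflective subcategories of \<open>A\<close>: the fully faithful functors \<open>j\<^sub>*\<close> and \<open>i\<^sub>*\<close>
  have the left adjoints \<open>j\<^sup>*\<close> and \<open>i\<^sup>*\<close>. Let \<open>G : D \<rightarrow> C\<close> be a fully faithful functor with a left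
  adjoint \<open>F\<close>. By adjunction \<open>F\<close> sends a generator to a generator (\<open>reflection_generator\<close>), and
  colimits in \<open>D\<close> are obtained by applying \<open>F\<close> to the colimits of the \<open>G\<close>-images in \<open>C\<close>
  (\<open>reflection_coproduct\<close>, \<open>reflection_direct_limit\<close>).

  The exactness of direct limits needs a second adjunction, and a different one in the two cases.

  For \<open>X\<close>, note that direct limits always preserve cokernels, so the point is to preserve
  monomorphisms. The functor \<open>j\<^sub>*\<close> preserves monomorphisms as a right adjoint, direct limits in \<open>A\<close>
  preserve them by hypothesis, and \<open>j\<^sup>*\<close>, which computes the limit in \<open>X\<close>, preserves them because it
  is right adjoint to \<open>j\<^sub>!\<close> (\<open>reflection_has_exact_direct_limits\<close>).

  For \<open>Y\<close>, the functor \<open>i\<^sup>*\<close> need not preserve monomorphisms. However \<open>i\<^sub>*\<close> has the right adjoint \<open>i\<^sup>!\<close>,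
  so it preserves direct limits and short exact sequences; being fully faithful it also reflects the
  latter, and exactness in \<open>A\<close> descends to \<open>Y\<close> (\<open>bireflection_has_exact_direct_limits\<close>).
\<close>


section \<open>Categories and direct limits\<close>

context category
begin

lemma Hom_Dom: "f \<in> Hom C X Y \<Longrightarrow> Dom C f = X"
  and Hom_Cod: "f \<in> Hom C X Y \<Longrightarrow> Cod C f = Y"
  and Hom_Ar: "f \<in> Hom C X Y \<Longrightarrow> f \<in> Ar C"
  by (auto simp: Hom_def)

lemma Hom_source: "f \<in> Hom C X Y \<Longrightarrow> X \<in> Ob C"
  using Dom_in_Ob by (auto simp: Hom_def)

lemma Hom_target: "f \<in> Hom C X Y \<Longrightarrow> Y \<in> Ob C"
  using Cod_in_Ob by (auto simp: Hom_def)

lemma monomorphism_cancel: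
  assumes "monomorphism C f" "f \<in> Hom C X Y" "g \<in> Hom C W X" "h \<in> Hom C W X" "f \<cdot> g = f \<cdot> h"
  shows "g = h"
  using assms Hom_source[OF assms(3)] unfolding monomorphism_def by (auto simp: Hom_Dom)

lemma monomorphismI:
  assumes "f \<in> Hom C X Y"
    and "\<And>W g h. \<lbrakk>g \<in> Hom C W X; h \<in> Hom C W X; f \<cdot> g = f \<cdot> h\<rbrakk> \<Longrightarrow> g = h"
  shows "monomorphism C f"
  using assms unfolding monomorphism_def by (auto simp: Hom_Dom Hom_Ar)

lemma epimorphism_cancel:
  assumes "epimorphism C f" "f \<in> Hom C X Y" "g \<in> Hom C Y Z" "h \<in> Hom C Y Z" "g \<cdot> f = h \<cdot> f"
  shows "g = h"
  using assms Hom_target[OF assms(3)] unfolding epimorphism_def by (auto simp: Hom_Cod)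

lemma epimorphismI:
  assumes "f \<in> Hom C X Y"
    and "\<And>Z g h. \<lbrakk>g \<in> Hom C Y Z; h \<in> Hom C Y Z; g \<cdot> f = h \<cdot> f\<rbrakk> \<Longrightarrow> g = h"
  shows "epimorphism C f"
  using assms unfolding epimorphism_def by (auto simp: Hom_Cod Hom_Ar)

lemma direct_limit_cocone: "is_direct_limit C I r X t L a \<Longrightarrow> is_cocone C I r X t L a"
  by (simp add: is_direct_limit_def)

lemma direct_limit_leg: "\<lbrakk>is_direct_limit C I r X t L a; i \<in> I\<rbrakk> \<Longrightarrow> a i \<in> Hom C (X i) L"
  by (simp add: is_direct_limit_def is_cocone_def)

lemma direct_limit_desc:
  assumes "is_direct_limit C I r X t L a" "is_cocone C I r X t Z b"
  obtains u where "u \<in> Hom C L Z" "\<And>i. i \<in> I \<Longrightarrow> u \<cdot> a i = b i"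
  using assms unfolding is_direct_limit_def by blast

lemma cocone_postcompose:
  assumes "is_cocone C I r X t L a" "direct_system C I r X t" "r \<subseteq> I \<times> I" "u \<in> Hom C L Z"
  shows "is_cocone C I r X t Z (\<lambda>i. u \<cdot> a i)"
  unfolding is_cocone_def
proof (intro conjI ballI allI impI)
  show "Z \<in> Ob C" using Hom_target[OF assms(4)] .
next
  fix i assume "i \<in> I"
  then show "u \<cdot> a i \<in> Hom C (X i) Z"
    using assms(1,4) Cmp_in_Hom by (auto simp: is_cocone_def)
next
  fix i j assume ij: "(i, j) \<in> r"
  then have "j \<in> I" using assms(3) by auto
  have "u \<cdot> a j \<cdot> t i j = u \<cdot> (a j \<cdot> t i j)"
    using Cmp_assoc[of "t i j" "X i" "X j" "a j" L u Z] assms(1,2,4) ij \<open>j \<in> I\<close>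
    by (auto simp: is_cocone_def direct_system_def)
  then show "u \<cdot> a j \<cdot> t i j = u \<cdot> a i"
    using assms(1) ij by (simp add: is_cocone_def)
qed

lemma direct_limit_hom_ext:
  assumes "is_direct_limit C I r X t L a" "direct_system C I r X t" "r \<subseteq> I \<times> I"
    and "u \<in> Hom C L Z" "v \<in> Hom C L Z" "\<And>i. i \<in> I \<Longrightarrow> u \<cdot> a i = v \<cdot> a i"
  shows "u = v"
proof -
  have "is_cocone C I r X t Z (\<lambda>i. u \<cdot> a i)"
    using cocone_postcompose[OF direct_limit_cocone] assms by blast
  then have "\<exists>!w. w \<in> Hom C L Z \<and> (\<forall>i\<in>I. w \<cdot> a i = u \<cdot> a i)"
    using assms(1) by (simp add: is_direct_limit_def)
  then show ?thesis using assms(4-6) by (smt (verit))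
qed

lemma cocone_precompose_map:
  assumes "direct_system C I r X t" "direct_system C I r X' t'" "r \<subseteq> I \<times> I"
    and "direct_system_map C I r X t X' t' f" "is_cocone C I r X' t' Z b"
  shows "is_cocone C I r X t Z (\<lambda>i. b i \<cdot> f i)"
  unfolding is_cocone_def
proof (intro conjI ballI allI impI)
  show "Z \<in> Ob C" using assms(5) by (simp add: is_cocone_def)
next
  fix i assume "i \<in> I"
  then show "b i \<cdot> f i \<in> Hom C (X i) Z"
    using assms(4,5) Cmp_in_Hom by (auto simp: is_cocone_def direct_system_map_def)
next
  fix i j assume ij: "(i, j) \<in> r"
  then have "i \<in> I" "j \<in> I" using assms(3) by auto
  then have t: "t i j \<in> Hom C (X i) (X j)" "t' i j \<in> Hom C (X' i) (X' j)"
    and f: "f i \<in> Hom C (X i) (X' i)" "f j \<in> Hom C (X j) (X' j)"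
    and b: "b j \<in> Hom C (X' j) Z"
    using assms ij by (auto simp: is_cocone_def direct_system_map_def direct_system_def)
  have "b j \<cdot> f j \<cdot> t i j = b j \<cdot> (f j \<cdot> t i j)" using Cmp_assoc[OF t(1) f(2) b] .
  also have "\<dots> = b j \<cdot> (t' i j \<cdot> f i)" using assms(4) ij by (simp add: direct_system_map_def)
  also have "\<dots> = b j \<cdot> t' i j \<cdot> f i" using Cmp_assoc[OF f(1) t(2) b] by simp
  also have "\<dots> = b i \<cdot> f i" using assms(5) ij by (simp add: is_cocone_def)
  finally show "b j \<cdot> f j \<cdot> t i j = b i \<cdot> f i" .
qed

text \<open>
  Two choices of direct limits differ by isomorphisms that commute with the induced maps, and a
  monomorphism stays one after composing with isomorphisms.
\<close>

lemma monomorphism_between_direct_limits: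
  assumes sys: "direct_system C I r X t" "direct_system C I r X' t'" "r \<subseteq> I \<times> I"
    and f: "direct_system_map C I r X t X' t' f"
    and lim: "is_direct_limit C I r X t L a" "is_direct_limit C I r X' t' L' a'"
    and lim2: "is_direct_limit C I r X t M b" "is_direct_limit C I r X' t' M' b'"
    and u: "u \<in> Hom C L L'" "\<And>i. i \<in> I \<Longrightarrow> u \<cdot> a i = a' i \<cdot> f i"
    and w: "w \<in> Hom C M M'" "\<And>i. i \<in> I \<Longrightarrow> w \<cdot> b i = b' i \<cdot> f i" and mono: "monomorphism C w"
  shows "monomorphism C u"
proof -
  obtain e where e: "e \<in> Hom C L M" "\<And>i. i \<in> I \<Longrightarrow> e \<cdot> a i = b i"
    using direct_limit_desc[OF lim(1) direct_limit_cocone[OF lim2(1)]] by metis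
  obtain d where d: "d \<in> Hom C M L" "\<And>i. i \<in> I \<Longrightarrow> d \<cdot> b i = a i"
    using direct_limit_desc[OF lim2(1) direct_limit_cocone[OF lim(1)]] by metis
  obtain e' where e': "e' \<in> Hom C L' M'" "\<And>i. i \<in> I \<Longrightarrow> e' \<cdot> a' i = b' i"
    using direct_limit_desc[OF lim(2) direct_limit_cocone[OF lim2(2)]] by metis
  have de: "d \<cdot> e = Idn C L"
  proof (rule direct_limit_hom_ext[OF lim(1) sys(1) sys(3)])
    show "d \<cdot> e \<in> Hom C L L" using Cmp_in_Hom[OF e(1) d(1)] .
    show "Idn C L \<in> Hom C L L" using Idn_in_Hom[OF Hom_source[OF e(1)]] .
    fix i assume i: "i \<in> I"
    show "d \<cdot> e \<cdot> a i = Idn C L \<cdot> a i"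
      using Cmp_assoc[OF direct_limit_leg[OF lim(1) i] e(1) d(1)] e(2)[OF i] d(2)[OF i]
        Cmp_Idn_left[OF direct_limit_leg[OF lim(1) i]] by simp
  qed
  have square: "e' \<cdot> u = w \<cdot> e"
  proof (rule direct_limit_hom_ext[OF lim(1) sys(1) sys(3)])
    show "e' \<cdot> u \<in> Hom C L M'" using Cmp_in_Hom[OF u(1) e'(1)] .
    show "w \<cdot> e \<in> Hom C L M'" using Cmp_in_Hom[OF e(1) w(1)] .
    fix i assume i: "i \<in> I"
    have fi: "f i \<in> Hom C (X i) (X' i)" using f i by (simp add: direct_system_map_def)
    show "e' \<cdot> u \<cdot> a i = w \<cdot> e \<cdot> a i"
      using Cmp_assoc[OF direct_limit_leg[OF lim(1) i] u(1) e'(1)] u(2)[OF i]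
        Cmp_assoc[OF fi direct_limit_leg[OF lim(2) i] e'(1)] e'(2)[OF i]
        Cmp_assoc[OF direct_limit_leg[OF lim(1) i] e(1) w(1)] e(2)[OF i] w(2)[OF i] by simp
  qed
  show ?thesis
  proof (rule monomorphismI[OF u(1)])
    fix W g h assume g: "g \<in> Hom C W L" and h: "h \<in> Hom C W L" and "u \<cdot> g = u \<cdot> h"
    then have "w \<cdot> (e \<cdot> g) = w \<cdot> (e \<cdot> h)"
      using square Cmp_assoc[OF _ u(1) e'(1)] Cmp_assoc[OF _ e(1) w(1)] by metis
    then have "e \<cdot> g = e \<cdot> h"
      using monomorphism_cancel[OF mono w(1)] Cmp_in_Hom[OF _ e(1)] g h by blast
    then show "g = h"
      using de Cmp_assoc[OF _ e(1) d(1)] Cmp_Idn_left g h by metis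
  qed
qed

end


section \<open>Kernels, cokernels and right exactness of direct limits\<close>

context preadditive_category
begin

lemma Zer_in_Hom: "\<lbrakk>X \<in> Ob C; Y \<in> Ob C\<rbrakk> \<Longrightarrow> Zer C X Y \<in> Hom C X Y"
  using monoid.one_closed[OF comm_monoid.axioms(1)[OF comm_group.axioms(1)[OF Hom_comm_group]]]
  by (simp add: Hom_group_def)

lemma Add_idempotent_Zer:
  assumes "f \<in> Hom C X Y" "Add C f f = f"
  shows "f = Zer C X Y"
proof -
  have "comm_group (Hom_group C X Y)"
    using Hom_comm_group[OF Hom_source[OF assms(1)] Hom_target[OF assms(1)]] .
  then have "group (Hom_group C X Y)" by (rule comm_group.axioms(2))
  then show ?thesis
    using group.l_cancel_one'[of "Hom_group C X Y" f f] assms by (simp add: Hom_group_def)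
qed

lemma Add_Zer_Zer:
  assumes "X \<in> Ob C" "Y \<in> Ob C"
  shows "Add C (Zer C X Y) (Zer C X Y) = Zer C X Y"
proof -
  have "comm_group (Hom_group C X Y)" using Hom_comm_group[OF assms] .
  then have "monoid (Hom_group C X Y)"
    by (intro comm_monoid.axioms(1) comm_group.axioms(1))
  then show ?thesis
    using monoid.l_one[of "Hom_group C X Y" "Zer C X Y"] Zer_in_Hom[OF assms]
    by (simp add: Hom_group_def)
qed

lemma Zer_Cmp:
  assumes "f \<in> Hom C X Y" "Z \<in> Ob C"
  shows "Zer C Y Z \<cdot> f = Zer C X Z"
proof -
  note z = Zer_in_Hom[OF Hom_target[OF assms(1)] assms(2)]
  show ?thesis
    using Add_idempotent_Zer[OF Cmp_in_Hom[OF assms(1) z]] Cmp_Add_left[OF assms(1) z z]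
      Add_Zer_Zer[OF Hom_target[OF assms(1)] assms(2)] by simp
qed

lemma Cmp_Zer:
  assumes "f \<in> Hom C Y Z" "X \<in> Ob C"
  shows "f \<cdot> Zer C X Y = Zer C X Z"
proof -
  note z = Zer_in_Hom[OF assms(2) Hom_source[OF assms(1)]]
  show ?thesis
    using Add_idempotent_Zer[OF Cmp_in_Hom[OF z assms(1)]] Cmp_Add_right[OF z z assms(1)]
      Add_Zer_Zer[OF assms(2) Hom_source[OF assms(1)]] by simp
qed

lemma is_kernel_iff:
  assumes "k \<in> Hom C K X" "f \<in> Hom C X Y"
  shows "is_kernel C k f \<longleftrightarrow> f \<cdot> k = Zer C K Y \<and>
    (\<forall>W. \<forall>h\<in>Hom C W X. f \<cdot> h = Zer C W Y \<longrightarrow> (\<exists>!u. u \<in> Hom C W K \<and> k \<cdot> u = h))"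
proof -
  have "(\<forall>W\<in>Ob C. \<forall>h\<in>Hom C W X. P W h) \<longleftrightarrow> (\<forall>W. \<forall>h\<in>Hom C W X. P W h)" for P
    using Hom_source by blast
  then show ?thesis
    using assms by (simp add: is_kernel_def Hom_Dom[OF assms(1)] Hom_Cod[OF assms(1)]
        Hom_Dom[OF assms(2)] Hom_Cod[OF assms(2)] Hom_Ar)
qed

lemma is_cokernel_iff:
  assumes "c \<in> Hom C Y Q" "f \<in> Hom C X Y"
  shows "is_cokernel C c f \<longleftrightarrow> c \<cdot> f = Zer C X Q \<and>
    (\<forall>Z. \<forall>h\<in>Hom C Y Z. h \<cdot> f = Zer C X Z \<longrightarrow> (\<exists>!u. u \<in> Hom C Q Z \<and> u \<cdot> c = h))"
proof -
  have "(\<forall>Z\<in>Ob C. \<forall>h\<in>Hom C Y Z. P Z h) \<longleftrightarrow> (\<forall>Z. \<forall>h\<in>Hom C Y Z. P Z h)" for P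
    using Hom_target by blast
  then show ?thesis
    using assms by (simp add: is_cokernel_def Hom_Dom[OF assms(1)] Hom_Cod[OF assms(1)]
        Hom_Dom[OF assms(2)] Hom_Cod[OF assms(2)] Hom_Ar)
qed

lemma kernel_monomorphism:
  assumes "is_kernel C k f"
  shows "monomorphism C k"
proof -
  have k: "k \<in> Hom C (Dom C k) (Dom C f)" and f: "f \<in> Hom C (Dom C f) (Cod C f)"
    using assms by (auto simp: is_kernel_def Hom_def)
  show ?thesis
  proof (rule monomorphismI[OF k])
    fix W g h assume g: "g \<in> Hom C W (Dom C k)" and h: "h \<in> Hom C W (Dom C k)"
      and eq: "k \<cdot> g = k \<cdot> h"
    have "f \<cdot> (k \<cdot> g) = Zer C W (Cod C f)"
      using Cmp_assoc[OF g k f] Zer_Cmp[OF g Hom_target[OF f]] assms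
      by (simp add: is_kernel_def)
    then have "\<exists>!u. u \<in> Hom C W (Dom C k) \<and> k \<cdot> u = k \<cdot> g"
      using assms Cmp_in_Hom[OF g k] Hom_source[OF g] by (simp add: is_kernel_def)
    then show "g = h" using g h eq by metis
  qed
qed

lemma cokernel_epimorphism:
  assumes "is_cokernel C c f"
  shows "epimorphism C c"
proof -
  have c: "c \<in> Hom C (Cod C f) (Cod C c)" and f: "f \<in> Hom C (Dom C f) (Cod C f)"
    using assms by (auto simp: is_cokernel_def Hom_def)
  show ?thesis
  proof (rule epimorphismI[OF c])
    fix Z g h assume g: "g \<in> Hom C (Cod C c) Z" and h: "h \<in> Hom C (Cod C c) Z"
      and eq: "g \<cdot> c = h \<cdot> c"
    have "g \<cdot> c \<cdot> f = Zer C (Dom C f) Z"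
      using Cmp_assoc[OF f c g] Cmp_Zer[OF g Hom_source[OF f]] assms
      by (simp add: is_cokernel_def)
    then have "\<exists>!u. u \<in> Hom C (Cod C c) Z \<and> u \<cdot> c = g \<cdot> c"
      using assms Cmp_in_Hom[OF c g] Hom_target[OF g] by (simp add: is_cokernel_def)
    then show "g = h" using g h eq by metis
  qed
qed

text \<open>
  Colimits commute with colimits. In an abelian category this reduces the exactness of direct limits
  to the preservation of monomorphisms.
\<close>

lemma cokernel_direct_limit:
  assumes sys: "direct_system C I r X t" "direct_system C I r X' t'" "direct_system C I r X'' t''"
    and r: "r \<subseteq> I \<times> I"
    and f: "direct_system_map C I r X t X' t' f" and g: "direct_system_map C I r X' t' X'' t'' g"
    and coker: "\<And>i. i \<in> I \<Longrightarrow> is_cokernel C (g i) (f i)"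
    and lim: "is_direct_limit C I r X t L a" "is_direct_limit C I r X' t' L' a'"
      "is_direct_limit C I r X'' t'' L'' a''"
    and u: "u \<in> Hom C L L'" "\<And>i. i \<in> I \<Longrightarrow> u \<cdot> a i = a' i \<cdot> f i"
    and v: "v \<in> Hom C L' L''" "\<And>i. i \<in> I \<Longrightarrow> v \<cdot> a' i = a'' i \<cdot> g i"
  shows "is_cokernel C v u"
  unfolding is_cokernel_iff[OF v(1) u(1)]
proof (intro conjI allI ballI impI)
  have fH: "f i \<in> Hom C (X i) (X' i)" and gH: "g i \<in> Hom C (X' i) (X'' i)" if "i \<in> I" for i
    using f g that by (auto simp: direct_system_map_def)
  note aH = direct_limit_leg[OF lim(1)] and a'H = direct_limit_leg[OF lim(2)]
    and a''H = direct_limit_leg[OF lim(3)]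
  have gf: "g i \<cdot> f i = Zer C (X i) (X'' i)" if "i \<in> I" for i
    using coker[OF that] by (simp add: is_cokernel_iff[OF gH fH] that)
  show "v \<cdot> u = Zer C L L''"
  proof (rule direct_limit_hom_ext[OF lim(1) sys(1) r])
    show "v \<cdot> u \<in> Hom C L L''" using Cmp_in_Hom[OF u(1) v(1)] .
    show "Zer C L L'' \<in> Hom C L L''" using Zer_in_Hom[OF Hom_source[OF u(1)] Hom_target[OF v(1)]] .
    fix i assume i: "i \<in> I"
    have "v \<cdot> u \<cdot> a i = v \<cdot> (a' i \<cdot> f i)" using Cmp_assoc[OF aH[OF i] u(1) v(1)] u(2)[OF i] by simp
    also have "\<dots> = a'' i \<cdot> g i \<cdot> f i"
      using Cmp_assoc[OF fH[OF i] a'H[OF i] v(1)] v(2)[OF i] by simp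
    also have "\<dots> = a'' i \<cdot> (g i \<cdot> f i)" using Cmp_assoc[OF fH[OF i] gH[OF i] a''H[OF i]] .
    also have "\<dots> = Zer C (X i) L''"
      using gf[OF i] Cmp_Zer[OF a''H[OF i] Hom_source[OF fH[OF i]]] by simp
    also have "\<dots> = Zer C L L'' \<cdot> a i" using Zer_Cmp[OF aH[OF i] Hom_target[OF v(1)]] by simp
    finally show "v \<cdot> u \<cdot> a i = Zer C L L'' \<cdot> a i" .
  qed
  fix Z h assume h: "h \<in> Hom C L' Z" and hu: "h \<cdot> u = Zer C L Z"
  have ha'H: "h \<cdot> a' i \<in> Hom C (X' i) Z" if "i \<in> I" for i using Cmp_in_Hom[OF a'H[OF that] h] .
  have ex: "\<exists>!w. w \<in> Hom C (X'' i) Z \<and> w \<cdot> g i = h \<cdot> a' i" if i: "i \<in> I" for i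
  proof -
    have "h \<cdot> a' i \<cdot> f i = h \<cdot> u \<cdot> a i"
      using Cmp_assoc[OF fH[OF i] a'H[OF i] h] Cmp_assoc[OF aH[OF i] u(1) h] u(2)[OF i] by simp
    then have "h \<cdot> a' i \<cdot> f i = Zer C (X i) Z"
      using hu Zer_Cmp[OF aH[OF i] Hom_target[OF h]] by simp
    then show ?thesis
      using coker[OF i] ha'H[OF i] by (simp add: is_cokernel_iff[OF gH fH] i)
  qed
  then obtain w where w: "\<And>i. i \<in> I \<Longrightarrow> w i \<in> Hom C (X'' i) Z"
      "\<And>i. i \<in> I \<Longrightarrow> w i \<cdot> g i = h \<cdot> a' i"
    by metis
  \<comment> \<open>Each \<open>g i\<close> is an epimorphism, so compatibility of the \<open>w i\<close> can be checked after composing with it.\<close>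
  have cocone: "is_cocone C I r X'' t'' Z w"
    unfolding is_cocone_def
  proof (intro conjI ballI allI impI)
    show "Z \<in> Ob C" using Hom_target[OF h] .
    show "w i \<in> Hom C (X'' i) Z" if "i \<in> I" for i using w(1) that .
    fix i j assume ij: "(i, j) \<in> r"
    then have i: "i \<in> I" and j: "j \<in> I" using r by auto
    have t': "t' i j \<in> Hom C (X' i) (X' j)" and t'': "t'' i j \<in> Hom C (X'' i) (X'' j)"
      using sys ij by (auto simp: direct_system_def)
    have "w j \<cdot> t'' i j \<cdot> g i = w j \<cdot> (g j \<cdot> t' i j)"
      using Cmp_assoc[OF gH[OF i] t'' w(1)[OF j]] g ij by (simp add: direct_system_map_def)
    also have "\<dots> = h \<cdot> (a' j \<cdot> t' i j)"
      using Cmp_assoc[OF t' gH[OF j] w(1)[OF j]] w(2)[OF j] Cmp_assoc[OF t' a'H[OF j] h] by simp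
    also have "\<dots> = w i \<cdot> g i"
      using direct_limit_cocone[OF lim(2)] ij w(2)[OF i] by (simp add: is_cocone_def)
    finally show "w j \<cdot> t'' i j = w i"
      using epimorphism_cancel[OF cokernel_epimorphism[OF coker[OF i]] gH[OF i]]
        Cmp_in_Hom[OF t'' w(1)[OF j]] w(1)[OF i] by blast
  qed
  obtain x where x: "x \<in> Hom C L'' Z" "\<And>i. i \<in> I \<Longrightarrow> x \<cdot> a'' i = w i"
    using direct_limit_desc[OF lim(3) cocone] by metis
  show "\<exists>!x. x \<in> Hom C L'' Z \<and> x \<cdot> v = h"
  proof (intro ex1I conjI)
    show "x \<in> Hom C L'' Z" using x(1) .
    show "x \<cdot> v = h"
    proof (rule direct_limit_hom_ext[OF lim(2) sys(2) r])
      show "x \<cdot> v \<in> Hom C L' Z" using Cmp_in_Hom[OF v(1) x(1)] .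
      show "h \<in> Hom C L' Z" using h .
      fix i assume i: "i \<in> I"
      show "x \<cdot> v \<cdot> a' i = h \<cdot> a' i"
        using Cmp_assoc[OF a'H[OF i] v(1) x(1)] v(2)[OF i]
          Cmp_assoc[OF gH[OF i] a''H[OF i] x(1)] x(2)[OF i] w(2)[OF i] by simp
    qed
    fix y assume y: "y \<in> Hom C L'' Z \<and> y \<cdot> v = h"
    then have yH: "y \<in> Hom C L'' Z" by simp
    show "y = x"
    proof (rule direct_limit_hom_ext[OF lim(3) sys(3) r yH x(1)])
      fix i assume i: "i \<in> I"
      have "y \<cdot> a'' i \<cdot> g i = h \<cdot> a' i"
        using Cmp_assoc[OF gH[OF i] a''H[OF i] yH] v(2)[OF i] y
          Cmp_assoc[OF a'H[OF i] v(1) yH] by simp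
      then show "y \<cdot> a'' i = x \<cdot> a'' i"
        using ex[OF i] w[OF i] x(2)[OF i] Cmp_in_Hom[OF a''H[OF i] yH] by metis
    qed
  qed
qed

text \<open>
  The transition maps are those induced on cokernels. Since the \<open>c i\<close> are epimorphisms, they inherit
  the functoriality of \<open>t'\<close>.
\<close>

lemma cokernel_direct_system:
  assumes sys: "direct_system C I r X t" "direct_system C I r X' t'" and pre: "preorder_on I r"
    and f: "direct_system_map C I r X t X' t' f"
    and coker: "\<And>i. i \<in> I \<Longrightarrow> is_cokernel C (c i) (f i)"
  obtains t'' where "direct_system C I r (\<lambda>i. Cod C (c i)) t''"
    and "direct_system_map C I r X' t' (\<lambda>i. Cod C (c i)) t'' c"
proof -
  have r: "r \<subseteq> I \<times> I" and refl: "\<And>i. i \<in> I \<Longrightarrow> (i, i) \<in> r" and trans: "trans r"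
    using pre by (auto simp: preorder_on_def refl_on_def)
  let ?Q = "\<lambda>i. Cod C (c i)"
  have fH: "f i \<in> Hom C (X i) (X' i)" if "i \<in> I" for i
    using f that by (simp add: direct_system_map_def)
  have cH: "c i \<in> Hom C (X' i) (?Q i)" if "i \<in> I" for i
    using coker[OF that] Hom_Cod[OF fH[OF that]] by (simp add: is_cokernel_def Hom_def)
  have epi: "epimorphism C (c i)" if "i \<in> I" for i using cokernel_epimorphism[OF coker[OF that]] .
  have tH: "t i j \<in> Hom C (X i) (X j)" and t'H: "t' i j \<in> Hom C (X' i) (X' j)" if "(i, j) \<in> r" for i j
    using sys that by (auto simp: direct_system_def)
  have "\<exists>s. s \<in> Hom C (?Q i) (?Q j) \<and> s \<cdot> c i = c j \<cdot> t' i j" if ij: "(i, j) \<in> r" for i j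
  proof -
    have i: "i \<in> I" and j: "j \<in> I" using ij r by auto
    have "c j \<cdot> t' i j \<cdot> f i = c j \<cdot> (f j \<cdot> t i j)"
      using Cmp_assoc[OF fH[OF i] t'H[OF ij] cH[OF j]] f ij by (simp add: direct_system_map_def)
    also have "\<dots> = c j \<cdot> f j \<cdot> t i j"
      using Cmp_assoc[OF tH[OF ij] fH[OF j] cH[OF j]] by simp
    also have "\<dots> = Zer C (X i) (?Q j)"
      using coker[OF j] is_cokernel_iff[OF cH fH] j Zer_Cmp[OF tH[OF ij] Hom_target[OF cH[OF j]]]
      by simp
    finally show ?thesis
      using coker[OF i] Cmp_in_Hom[OF t'H[OF ij] cH[OF j]] is_cokernel_iff[OF cH fH, OF i i] by blast
  qed
  then obtain s where sH: "\<And>i j. (i, j) \<in> r \<Longrightarrow> s i j \<in> Hom C (?Q i) (?Q j)"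
    and sc: "\<And>i j. (i, j) \<in> r \<Longrightarrow> s i j \<cdot> c i = c j \<cdot> t' i j"
    by metis
  have "direct_system C I r ?Q s"
    unfolding direct_system_def
  proof (intro conjI ballI allI impI)
    fix i assume i: "i \<in> I"
    show Q: "?Q i \<in> Ob C" using Hom_target[OF cH[OF i]] .
    have "s i i \<cdot> c i = Idn C (?Q i) \<cdot> c i"
      using sc[OF refl[OF i]] sys(2) i Cmp_Idn_left[OF cH[OF i]] Cmp_Idn_right[OF cH[OF i]]
      by (simp add: direct_system_def)
    then show "s i i = Idn C (?Q i)"
      using epimorphism_cancel[OF epi[OF i] cH[OF i] sH[OF refl[OF i]] Idn_in_Hom[OF Q]] by simp
  next
    show "s i j \<in> Hom C (?Q i) (?Q j)" if "(i, j) \<in> r" for i j using sH[OF that] .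
  next
    fix i j k assume ij: "(i, j) \<in> r" and jk: "(j, k) \<in> r"
    then have i: "i \<in> I" and j: "j \<in> I" and k: "k \<in> I" and ik: "(i, k) \<in> r"
      using r transD[OF trans ij jk] by auto
    have "s j k \<cdot> s i j \<cdot> c i = s j k \<cdot> (c j \<cdot> t' i j)"
      using Cmp_assoc[OF cH[OF i] sH[OF ij] sH[OF jk]] sc[OF ij] by simp
    also have "\<dots> = c k \<cdot> t' j k \<cdot> t' i j"
      using Cmp_assoc[OF t'H[OF ij] cH[OF j] sH[OF jk]] sc[OF jk] by simp
    also have "\<dots> = c k \<cdot> (t' j k \<cdot> t' i j)" using Cmp_assoc[OF t'H[OF ij] t'H[OF jk] cH[OF k]] .
    also have "\<dots> = s i k \<cdot> c i"
      using sys(2) ij jk sc[OF ik] by (simp add: direct_system_def)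
    finally show "s j k \<cdot> s i j = s i k"
      using epimorphism_cancel[OF epi[OF i] cH[OF i] Cmp_in_Hom[OF sH[OF ij] sH[OF jk]] sH[OF ik]]
      by simp
  qed
  moreover have "direct_system_map C I r X' t' ?Q s c"
    using cH sc by (simp add: direct_system_map_def)
  ultimately show ?thesis by (rule that)
qed

end

lemma direct_limit_exists:
  fixes \<kappa> :: "'k rel" and I :: "'k set"
  assumes "has_exact_direct_limits \<kappa> C" "small \<kappa> I" "directed_set I r" "direct_system C I r X t"
  obtains L a where "is_direct_limit C I r X t L a"
  using assms(1)[unfolded has_exact_direct_limits_def, THEN spec, THEN spec, THEN mp,
      OF conjI[OF assms(2,3)], THEN conjunct1, THEN spec, THEN spec, THEN mp, OF assms(4)]
  by (elim exE)

lemma direct_limit_short_exact: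
  fixes \<kappa> :: "'k rel" and I :: "'k set"
  assumes "has_exact_direct_limits \<kappa> C" "small \<kappa> I" "directed_set I r"
    and "direct_system C I r X t" "direct_system C I r X' t'" "direct_system C I r X'' t''"
    and "direct_system_map C I r X t X' t' f" "direct_system_map C I r X' t' X'' t'' g"
    and "\<And>i. i \<in> I \<Longrightarrow> short_exact C (f i) (g i)"
    and "is_direct_limit C I r X t L a" "is_direct_limit C I r X' t' L' a'"
      "is_direct_limit C I r X'' t'' L'' a''"
    and "u \<in> Hom C L L'" "\<And>i. i \<in> I \<Longrightarrow> u \<cdot>\<^bsub>C\<^esub> a i = a' i \<cdot>\<^bsub>C\<^esub> f i"
    and "v \<in> Hom C L' L''" "\<And>i. i \<in> I \<Longrightarrow> v \<cdot>\<^bsub>C\<^esub> a' i = a'' i \<cdot>\<^bsub>C\<^esub> g i"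
  shows "short_exact C u v"
  by (rule assms(1)[unfolded has_exact_direct_limits_def, THEN spec, THEN spec, THEN mp,
        OF conjI[OF assms(2,3)], THEN conjunct2, rule_format,
        of X t X' t' X'' t'' f g L a L' a' L'' a'' u v])
    (intro conjI ballI assms(4-16))

lemma has_exact_direct_limitsI:
  fixes \<kappa> :: "'k rel"
  assumes "\<And>(I :: 'k set) r X t. \<lbrakk>small \<kappa> I; directed_set I r; direct_system C I r X t\<rbrakk>
      \<Longrightarrow> \<exists>L a. is_direct_limit C I r X t L a"
    and "\<And>(I :: 'k set) r X t X' t' X'' t'' f g L a L' a' L'' a'' u v.
      \<lbrakk>small \<kappa> I; directed_set I r;
       direct_system C I r X t; direct_system C I r X' t'; direct_system C I r X'' t'';
       direct_system_map C I r X t X' t' f; direct_system_map C I r X' t' X'' t'' g;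
       \<And>i. i \<in> I \<Longrightarrow> short_exact C (f i) (g i);
       is_direct_limit C I r X t L a; is_direct_limit C I r X' t' L' a';
       is_direct_limit C I r X'' t'' L'' a'';
       u \<in> Hom C L L'; \<And>i. i \<in> I \<Longrightarrow> u \<cdot>\<^bsub>C\<^esub> a i = a' i \<cdot>\<^bsub>C\<^esub> f i;
       v \<in> Hom C L' L''; \<And>i. i \<in> I \<Longrightarrow> v \<cdot>\<^bsub>C\<^esub> a' i = a'' i \<cdot>\<^bsub>C\<^esub> g i\<rbrakk> \<Longrightarrow> short_exact C u v"
  shows "has_exact_direct_limits \<kappa> C"
  unfolding has_exact_direct_limits_def
proof (intro allI impI conjI)
  fix I :: "'k set" and r X t
  assume "small \<kappa> I \<and> directed_set I r" "direct_system C I r X t"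
  then show "\<exists>L a. is_direct_limit C I r X t L a" using assms(1) by simp
qed (elim conjE, rule assms(2), (assumption | erule (1) bspec)+)

context abelian_category
begin

text \<open>
  A monomorphism \<open>f\<close> is the kernel of some \<open>g\<close>. As \<open>g\<close> factors through the cokernel \<open>c\<close> of \<open>f\<close>, whatever
  \<open>c\<close> annihilates is annihilated by \<open>g\<close> and hence factors through \<open>f\<close>.
\<close>

lemma short_exact_if_monomorphism:
  assumes "monomorphism C f" "is_cokernel C c f"
  shows "short_exact C f c"
proof -
  obtain g where g: "is_kernel C f g" using mono_is_kernel[OF assms(1)] by blast
  define X where "X = Dom C f"
  define Y where "Y = Cod C f"
  define Q where "Q = Cod C c"
  define Z where "Z = Cod C g"
  have f: "f \<in> Hom C X Y" and cH: "c \<in> Hom C Y Q" and gH: "g \<in> Hom C Y Z"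
    using assms(2) g by (auto simp: X_def Y_def Q_def Z_def is_cokernel_def is_kernel_def Hom_def)
  have ker: "g \<cdot> f = Zer C X Z"
    "\<And>W h. h \<in> Hom C W Y \<Longrightarrow> g \<cdot> h = Zer C W Z \<Longrightarrow> \<exists>!u. u \<in> Hom C W X \<and> f \<cdot> u = h"
    using g is_kernel_iff[OF f gH] by blast+
  obtain g' where g': "g' \<in> Hom C Q Z" "g' \<cdot> c = g"
    using assms(2) ker(1) is_cokernel_iff[OF cH f] gH by blast
  have "is_kernel C f c"
    unfolding is_kernel_iff[OF f cH]
  proof (intro conjI allI ballI impI)
    show "c \<cdot> f = Zer C X Q" using assms(2) is_cokernel_iff[OF cH f] by blast
    fix W h assume h: "h \<in> Hom C W Y" and "c \<cdot> h = Zer C W Q"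
    then have "g \<cdot> h = Zer C W Z"
      using g' Cmp_assoc[OF h cH g'(1)] Cmp_Zer[OF g'(1) Hom_source[OF h]] by simp
    then show "\<exists>!u. u \<in> Hom C W X \<and> f \<cdot> u = h" using ker(2) h by blast
  qed
  then show ?thesis using assms(2) by (simp add: short_exact_def)
qed

text \<open>
  Exactness of direct limits speaks of short exact sequences only. To use it for monomorphisms, complete
  them to short exact sequences with their cokernels, which form a direct system again.
\<close>

lemma monomorphism_direct_limit:
  fixes \<kappa> :: "'k rel" and I :: "'k set"
  assumes exact: "has_exact_direct_limits \<kappa> C" and I: "small \<kappa> I" "directed_set I r"
    and sys: "direct_system C I r X t" "direct_system C I r X' t'"
    and f: "direct_system_map C I r X t X' t' f"
    and mono: "\<And>i. i \<in> I \<Longrightarrow> monomorphism C (f i)"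
    and lim: "is_direct_limit C I r X t L a" "is_direct_limit C I r X' t' L' a'"
    and u: "u \<in> Hom C L L'" "\<And>i. i \<in> I \<Longrightarrow> u \<cdot> a i = a' i \<cdot> f i"
  shows "monomorphism C u"
proof -
  have pre: "preorder_on I r" using I(2) by (simp add: directed_set_def)
  then have r: "r \<subseteq> I \<times> I" by (simp add: preorder_on_def)
  have "\<exists>c. is_cokernel C c (f i)" if "i \<in> I" for i
    using ex_cokernel mono[OF that] by (simp add: monomorphism_def)
  then obtain c where c: "\<And>i. i \<in> I \<Longrightarrow> is_cokernel C (c i) (f i)" by metis
  obtain s where s: "direct_system C I r (\<lambda>i. Cod C (c i)) s"
    and cs: "direct_system_map C I r X' t' (\<lambda>i. Cod C (c i)) s c"
    using cokernel_direct_system[OF sys pre f c] .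
  obtain M b where M: "is_direct_limit C I r (\<lambda>i. Cod C (c i)) s M b"
    using direct_limit_exists[OF exact I s] .
  obtain v where v: "v \<in> Hom C L' M" "\<And>i. i \<in> I \<Longrightarrow> v \<cdot> a' i = b i \<cdot> c i"
    using direct_limit_desc[OF lim(2)
        cocone_precompose_map[OF sys(2) s r cs direct_limit_cocone[OF M]]] by metis
  have "short_exact C (f i) (c i)" if "i \<in> I" for i
    using short_exact_if_monomorphism[OF mono[OF that] c[OF that]] .
  then have "short_exact C u v"
    by (rule direct_limit_short_exact[OF exact I sys s f cs _ lim M u v])
  then show ?thesis using kernel_monomorphism by (auto simp: short_exact_def)
qed

end


section \<open>Additive functors and adjunctions\<close>

locale functor_between_preadditive =
  C: preadditive_category C + D: preadditive_category D + additive_functor C D F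
  for C :: "('o, 'm, 'y) preadditive_data_scheme"
    and D :: "('p, 'n, 'z) preadditive_data_scheme"
    and F :: "('o, 'm, 'p, 'n) functor_data"
begin

lemma FAr_Zer:
  assumes "X \<in> Ob C" "Y \<in> Ob C"
  shows "FAr F (Zer C X Y) = Zer D (FOb F X) (FOb F Y)"
  using D.Add_idempotent_Zer[OF FAr_in_Hom[OF C.Zer_in_Hom[OF assms]]]
    FAr_Add[OF C.Zer_in_Hom[OF assms] C.Zer_in_Hom[OF assms]] C.Add_Zer_Zer[OF assms] by simp

lemma image_direct_system:
  assumes "direct_system C I r X t"
  shows "direct_system D I r (\<lambda>i. FOb F (X i)) (\<lambda>i j. FAr F (t i j))"
  unfolding direct_system_def
proof (intro conjI ballI allI impI)
  fix i assume "i \<in> I"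
  then show "FOb F (X i) \<in> Ob D" "FAr F (t i i) = Idn D (FOb F (X i))"
    using assms FOb_in_Ob FAr_Idn by (auto simp: direct_system_def)
next
  fix i j assume "(i, j) \<in> r"
  then show "FAr F (t i j) \<in> Hom D (FOb F (X i)) (FOb F (X j))"
    using assms FAr_in_Hom by (auto simp: direct_system_def)
next
  fix i j k assume "(i, j) \<in> r" "(j, k) \<in> r"
  then have "t i j \<in> Hom C (X i) (X j)" "t j k \<in> Hom C (X j) (X k)" "t j k \<cdot>\<^bsub>C\<^esub> t i j = t i k"
    using assms by (auto simp: direct_system_def)
  then show "FAr F (t j k) \<cdot>\<^bsub>D\<^esub> FAr F (t i j) = FAr F (t i k)"
    using FAr_Cmp by metis
qed

lemma image_direct_system_map:
  assumes "direct_system C I r X t" "direct_system C I r X' t'" "r \<subseteq> I \<times> I"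
    and "direct_system_map C I r X t X' t' f"
  shows "direct_system_map D I r (\<lambda>i. FOb F (X i)) (\<lambda>i j. FAr F (t i j))
    (\<lambda>i. FOb F (X' i)) (\<lambda>i j. FAr F (t' i j)) (\<lambda>i. FAr F (f i))"
  unfolding direct_system_map_def
proof (intro conjI ballI allI impI)
  fix i assume "i \<in> I"
  then show "FAr F (f i) \<in> Hom D (FOb F (X i)) (FOb F (X' i))"
    using assms(4) FAr_in_Hom by (auto simp: direct_system_map_def)
next
  fix i j assume ij: "(i, j) \<in> r"
  then have "i \<in> I" "j \<in> I" using assms(3) by auto
  then have "t i j \<in> Hom C (X i) (X j)" "t' i j \<in> Hom C (X' i) (X' j)"
    "f i \<in> Hom C (X i) (X' i)" "f j \<in> Hom C (X j) (X' j)" "f j \<cdot>\<^bsub>C\<^esub> t i j = t' i j \<cdot>\<^bsub>C\<^esub> f i"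
    using assms ij by (auto simp: direct_system_def direct_system_map_def)
  then show "FAr F (f j) \<cdot>\<^bsub>D\<^esub> FAr F (t i j) = FAr F (t' i j) \<cdot>\<^bsub>D\<^esub> FAr F (f i)"
    using FAr_Cmp by metis
qed

lemma image_cocone:
  assumes "direct_system C I r X t" "r \<subseteq> I \<times> I" "is_cocone C I r X t Z b"
  shows "is_cocone D I r (\<lambda>i. FOb F (X i)) (\<lambda>i j. FAr F (t i j)) (FOb F Z) (\<lambda>i. FAr F (b i))"
  unfolding is_cocone_def
proof (intro conjI ballI allI impI)
  show "FOb F Z \<in> Ob D" using assms(3) FOb_in_Ob by (simp add: is_cocone_def)
  show "FAr F (b i) \<in> Hom D (FOb F (X i)) (FOb F Z)" if "i \<in> I" for i
    using assms(3) FAr_in_Hom that by (simp add: is_cocone_def)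
  fix i j assume ij: "(i, j) \<in> r"
  then have "j \<in> I" using assms(2) by auto
  then have "t i j \<in> Hom C (X i) (X j)" "b j \<in> Hom C (X j) Z" "b j \<cdot>\<^bsub>C\<^esub> t i j = b i"
    using assms ij by (auto simp: direct_system_def is_cocone_def)
  then show "FAr F (b j) \<cdot>\<^bsub>D\<^esub> FAr F (t i j) = FAr F (b i)" using FAr_Cmp by metis
qed

end

locale fully_faithful_functor = functor_between_preadditive +
  assumes full_faithful: "fully_faithful C D F"
begin

lemma FAr_inj:
  assumes "f \<in> Hom C X Y" "g \<in> Hom C X Y" "FAr F f = FAr F g"
  shows "f = g"
  using full_faithful assms C.Hom_source[OF assms(1)] C.Hom_target[OF assms(1)]
  by (meson bij_betw_imp_inj_on fully_faithful_def inj_onD)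

lemma FAr_surj:
  assumes "X \<in> Ob C" "Y \<in> Ob C" "g \<in> Hom D (FOb F X) (FOb F Y)"
  obtains f where "f \<in> Hom C X Y" "FAr F f = g"
proof -
  have "FAr F ` Hom C X Y = Hom D (FOb F X) (FOb F Y)"
    using full_faithful assms(1,2) by (simp add: fully_faithful_def bij_betw_def)
  then show ?thesis using assms(3) that by (metis imageE)
qed

lemma FAr_eq_Zer_iff:
  assumes "f \<in> Hom C X Y"
  shows "FAr F f = Zer D (FOb F X) (FOb F Y) \<longleftrightarrow> f = Zer C X Y"
  using FAr_Zer FAr_inj assms C.Zer_in_Hom C.Hom_source C.Hom_target by metis

lemma reflects_kernel:
  assumes k: "k \<in> Hom C K X" and f: "f \<in> Hom C X Y" and ker: "is_kernel D (FAr F k) (FAr F f)"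
  shows "is_kernel C k f"
  unfolding C.is_kernel_iff[OF k f]
proof (intro conjI allI ballI impI)
  note ker' = ker[unfolded D.is_kernel_iff[OF FAr_in_Hom[OF k] FAr_in_Hom[OF f]]]
  show "f \<cdot>\<^bsub>C\<^esub> k = Zer C K Y"
    using ker' FAr_Cmp[OF k f] FAr_eq_Zer_iff[OF C.Cmp_in_Hom[OF k f]] by simp
  fix W h assume h: "h \<in> Hom C W X" and "f \<cdot>\<^bsub>C\<^esub> h = Zer C W Y"
  then have "FAr F f \<cdot>\<^bsub>D\<^esub> FAr F h = Zer D (FOb F W) (FOb F Y)"
    using FAr_Cmp[OF h f] FAr_Zer[OF C.Hom_source[OF h] C.Hom_target[OF f]] by simp
  then have ex: "\<exists>!u. u \<in> Hom D (FOb F W) (FOb F K) \<and> FAr F k \<cdot>\<^bsub>D\<^esub> u = FAr F h"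
    using ker' FAr_in_Hom[OF h] by blast
  then obtain v where v: "v \<in> Hom D (FOb F W) (FOb F K)" "FAr F k \<cdot>\<^bsub>D\<^esub> v = FAr F h" by blast
  obtain u where u: "u \<in> Hom C W K" "FAr F u = v"
    using FAr_surj[OF C.Hom_source[OF h] C.Hom_source[OF k] v(1)] .
  show "\<exists>!u. u \<in> Hom C W K \<and> k \<cdot>\<^bsub>C\<^esub> u = h"
  proof (intro ex1I conjI)
    show "u \<in> Hom C W K" using u(1) .
    show "k \<cdot>\<^bsub>C\<^esub> u = h"
      using FAr_inj[OF C.Cmp_in_Hom[OF u(1) k] h] FAr_Cmp[OF u(1) k] u(2) v(2) by simp
    fix w assume w: "w \<in> Hom C W K \<and> k \<cdot>\<^bsub>C\<^esub> w = h"
    then have "FAr F k \<cdot>\<^bsub>D\<^esub> FAr F w = FAr F h" using FAr_Cmp k by metis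
    then have "FAr F w = FAr F u" using ex v u(2) w FAr_in_Hom by metis
    then show "w = u" using FAr_inj w u(1) by blast
  qed
qed

lemma reflects_cokernel:
  assumes c: "c \<in> Hom C Y Q" and f: "f \<in> Hom C X Y" and coker: "is_cokernel D (FAr F c) (FAr F f)"
  shows "is_cokernel C c f"
  unfolding C.is_cokernel_iff[OF c f]
proof (intro conjI allI ballI impI)
  note coker' = coker[unfolded D.is_cokernel_iff[OF FAr_in_Hom[OF c] FAr_in_Hom[OF f]]]
  show "c \<cdot>\<^bsub>C\<^esub> f = Zer C X Q"
    using coker' FAr_Cmp[OF f c] FAr_eq_Zer_iff[OF C.Cmp_in_Hom[OF f c]] by simp
  fix Z h assume h: "h \<in> Hom C Y Z" and "h \<cdot>\<^bsub>C\<^esub> f = Zer C X Z"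
  then have "FAr F h \<cdot>\<^bsub>D\<^esub> FAr F f = Zer D (FOb F X) (FOb F Z)"
    using FAr_Cmp[OF f h] FAr_Zer[OF C.Hom_source[OF f] C.Hom_target[OF h]] by simp
  then have ex: "\<exists>!u. u \<in> Hom D (FOb F Q) (FOb F Z) \<and> u \<cdot>\<^bsub>D\<^esub> FAr F c = FAr F h"
    using coker' FAr_in_Hom[OF h] by blast
  then obtain v where v: "v \<in> Hom D (FOb F Q) (FOb F Z)" "v \<cdot>\<^bsub>D\<^esub> FAr F c = FAr F h" by blast
  obtain u where u: "u \<in> Hom C Q Z" "FAr F u = v"
    using FAr_surj[OF C.Hom_target[OF c] C.Hom_target[OF h] v(1)] .
  show "\<exists>!u. u \<in> Hom C Q Z \<and> u \<cdot>\<^bsub>C\<^esub> c = h"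
  proof (intro ex1I conjI)
    show "u \<in> Hom C Q Z" using u(1) .
    show "u \<cdot>\<^bsub>C\<^esub> c = h"
      using FAr_inj[OF C.Cmp_in_Hom[OF c u(1)] h] FAr_Cmp[OF c u(1)] u(2) v(2) by simp
    fix w assume w: "w \<in> Hom C Q Z \<and> w \<cdot>\<^bsub>C\<^esub> c = h"
    then have "FAr F w \<cdot>\<^bsub>D\<^esub> FAr F c = FAr F h" using FAr_Cmp c by metis
    then have "FAr F w = FAr F u" using ex v u(2) w FAr_in_Hom by metis
    then show "w = u" using FAr_inj w u(1) by blast
  qed
qed

end

locale additive_adjunction =
  C: preadditive_category C + D: preadditive_category D +
  F: functor_between_preadditive C D F + G: functor_between_preadditive D C G
  for C :: "('o, 'm, 'y) preadditive_data_scheme"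
    and D :: "('p, 'n, 'z) preadditive_data_scheme"
    and F :: "('o, 'm, 'p, 'n) functor_data"
    and G :: "('p, 'n, 'o, 'm) functor_data" +
  assumes adj: "adjunction C D F G"
begin

text \<open>
  Choosing the bijections \<open>Hom(F W, Z) \<cong> Hom(W, G Z)\<close> once and for all, instead of a unit and a
  counit, serves arguments about the left and about the right adjoint alike.
\<close>

definition transpose :: "'o \<Rightarrow> 'p \<Rightarrow> 'n \<Rightarrow> 'm" where
  "transpose = (SOME \<phi>.
     (\<forall>X\<in>Ob C. \<forall>Y\<in>Ob D. bij_betw (\<phi> X Y) (Hom D (FOb F X) Y) (Hom C X (FOb G Y))) \<and>
     (\<forall>X\<in>Ob C. \<forall>X'\<in>Ob C. \<forall>Y\<in>Ob D. \<forall>Y'\<in>Ob D.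
        \<forall>f\<in>Hom C X' X. \<forall>g\<in>Hom D Y Y'. \<forall>h\<in>Hom D (FOb F X) Y.
          \<phi> X' Y' (g \<cdot>\<^bsub>D\<^esub> h \<cdot>\<^bsub>D\<^esub> FAr F f) = FAr G g \<cdot>\<^bsub>C\<^esub> \<phi> X Y h \<cdot>\<^bsub>C\<^esub> f))"

lemma transpose_bij:
    "\<lbrakk>X \<in> Ob C; Y \<in> Ob D\<rbrakk>
       \<Longrightarrow> bij_betw (transpose X Y) (Hom D (FOb F X) Y) (Hom C X (FOb G Y))"
  and transpose_natural:
    "\<lbrakk>f \<in> Hom C X' X; g \<in> Hom D Y Y'; h \<in> Hom D (FOb F X) Y\<rbrakk> \<Longrightarrow>
       transpose X' Y' (g \<cdot>\<^bsub>D\<^esub> h \<cdot>\<^bsub>D\<^esub> FAr F f) = FAr G g \<cdot>\<^bsub>C\<^esub> transpose X Y h \<cdot>\<^bsub>C\<^esub> f"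
  using someI_ex[OF adj[unfolded adjunction_def], folded transpose_def]
  by (simp, meson C.Hom_source C.Hom_target D.Hom_source D.Hom_target)

lemma transpose_in_Hom:
  "\<lbrakk>h \<in> Hom D (FOb F W) Z; W \<in> Ob C\<rbrakk> \<Longrightarrow> transpose W Z h \<in> Hom C W (FOb G Z)"
  using transpose_bij bij_betwE D.Hom_target by meson

lemma transpose_inj:
  assumes "W \<in> Ob C" "h \<in> Hom D (FOb F W) Z" "h' \<in> Hom D (FOb F W) Z"
    and "transpose W Z h = transpose W Z h'"
  shows "h = h'"
  using transpose_bij[OF assms(1) D.Hom_target[OF assms(2)]] assms
  by (meson bij_betw_imp_inj_on inj_onD)

lemma transpose_surj:
  assumes "k \<in> Hom C W (FOb G Z)" "Z \<in> Ob D"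
  obtains h where "h \<in> Hom D (FOb F W) Z" "transpose W Z h = k"
  using transpose_bij[OF C.Hom_source[OF assms(1)] assms(2)] assms(1)
  by (metis bij_betw_imp_surj_on imageE)

lemma transpose_Cmp_left:
  assumes "W \<in> Ob C" "h \<in> Hom D (FOb F W) Y" "g \<in> Hom D Y Z"
  shows "transpose W Z (g \<cdot>\<^bsub>D\<^esub> h) = FAr G g \<cdot>\<^bsub>C\<^esub> transpose W Y h"
  using transpose_natural[OF C.Idn_in_Hom[OF assms(1)] assms(3,2)]
  by (simp add: F.FAr_Idn[OF assms(1)] D.Cmp_Idn_right[OF D.Cmp_in_Hom[OF assms(2,3)]]
      C.Cmp_Idn_right[OF C.Cmp_in_Hom[OF transpose_in_Hom[OF assms(2,1)] G.FAr_in_Hom[OF assms(3)]]])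

lemma transpose_Cmp_right:
  assumes "f \<in> Hom C V W" "h \<in> Hom D (FOb F W) Z"
  shows "transpose V Z (h \<cdot>\<^bsub>D\<^esub> FAr F f) = transpose W Z h \<cdot>\<^bsub>C\<^esub> f"
  using transpose_natural[OF assms(1) D.Idn_in_Hom[OF D.Hom_target[OF assms(2)]] assms(2)]
  by (simp add: D.Cmp_Idn_left[OF assms(2)] G.FAr_Idn[OF D.Hom_target[OF assms(2)]]
      C.Cmp_Idn_left[OF transpose_in_Hom[OF assms(2) C.Hom_target[OF assms(1)]]])

lemma transpose_Zer:
  assumes "W \<in> Ob C" "Z \<in> Ob D"
  shows "transpose W Z (Zer D (FOb F W) Z) = Zer C W (FOb G Z)"
proof -
  have FW: "FOb F W \<in> Ob D" using F.FOb_in_Ob[OF assms(1)] .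
  have id: "Idn D (FOb F W) \<in> Hom D (FOb F W) (FOb F W)" using D.Idn_in_Hom[OF FW] .
  have "transpose W Z (Zer D (FOb F W) Z \<cdot>\<^bsub>D\<^esub> Idn D (FOb F W))
      = FAr G (Zer D (FOb F W) Z) \<cdot>\<^bsub>C\<^esub> transpose W (FOb F W) (Idn D (FOb F W))"
    using transpose_Cmp_left[OF assms(1) id D.Zer_in_Hom[OF FW assms(2)]] .
  then show ?thesis
    using D.Cmp_Idn_right[OF D.Zer_in_Hom[OF FW assms(2)]] G.FAr_Zer[OF FW assms(2)]
      C.Zer_Cmp[OF transpose_in_Hom[OF id assms(1)] G.FOb_in_Ob[OF assms(2)]] by simp
qed

lemma transpose_eq_Zer_iff:
  assumes "W \<in> Ob C" "h \<in> Hom D (FOb F W) Z"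
  shows "transpose W Z h = Zer C W (FOb G Z) \<longleftrightarrow> h = Zer D (FOb F W) Z"
  using transpose_Zer transpose_inj D.Zer_in_Hom F.FOb_in_Ob D.Hom_target assms by metis

lemma right_adjoint_preserves_monomorphism:
  assumes f: "f \<in> Hom D X Y" and mono: "monomorphism D f"
  shows "monomorphism C (FAr G f)"
proof (rule C.monomorphismI[OF G.FAr_in_Hom[OF f]])
  fix W g h assume g: "g \<in> Hom C W (FOb G X)" and h: "h \<in> Hom C W (FOb G X)"
    and eq: "FAr G f \<cdot>\<^bsub>C\<^esub> g = FAr G f \<cdot>\<^bsub>C\<^esub> h"
  obtain g' where g': "g' \<in> Hom D (FOb F W) X" "transpose W X g' = g"
    using transpose_surj[OF g D.Hom_source[OF f]] .
  obtain h' where h': "h' \<in> Hom D (FOb F W) X" "transpose W X h' = h"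
    using transpose_surj[OF h D.Hom_source[OF f]] .
  note W = C.Hom_source[OF g]
  have "transpose W Y (f \<cdot>\<^bsub>D\<^esub> g') = transpose W Y (f \<cdot>\<^bsub>D\<^esub> h')"
    using transpose_Cmp_left[OF W g'(1) f] transpose_Cmp_left[OF W h'(1) f] g'(2) h'(2) eq by simp
  then have "f \<cdot>\<^bsub>D\<^esub> g' = f \<cdot>\<^bsub>D\<^esub> h'"
    using transpose_inj[OF W D.Cmp_in_Hom[OF g'(1) f] D.Cmp_in_Hom[OF h'(1) f]] by simp
  then show "g = h"
    using D.monomorphism_cancel[OF mono f g'(1) h'(1)] g'(2) h'(2) by simp
qed

text \<open>
  Transposition translates a factorization problem through \<open>G k\<close> in \<open>C\<close> into one through \<open>k\<close> in \<open>D\<close>.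
  Uniqueness holds since \<open>G k\<close> is a monomorphism.
\<close>

lemma right_adjoint_preserves_kernel:
  assumes k: "k \<in> Hom D K X" and f: "f \<in> Hom D X Y" and ker: "is_kernel D k f"
  shows "is_kernel C (FAr G k) (FAr G f)"
  unfolding C.is_kernel_iff[OF G.FAr_in_Hom[OF k] G.FAr_in_Hom[OF f]]
proof (intro conjI allI ballI impI)
  note ker' = ker[unfolded D.is_kernel_iff[OF k f]]
  show "FAr G f \<cdot>\<^bsub>C\<^esub> FAr G k = Zer C (FOb G K) (FOb G Y)"
    using ker' G.FAr_Cmp[OF k f] G.FAr_Zer[OF D.Hom_source[OF k] D.Hom_target[OF f]] by simp
  fix W h assume h: "h \<in> Hom C W (FOb G X)" and fh: "FAr G f \<cdot>\<^bsub>C\<^esub> h = Zer C W (FOb G Y)"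
  note W = C.Hom_source[OF h]
  obtain h' where h': "h' \<in> Hom D (FOb F W) X" "transpose W X h' = h"
    using transpose_surj[OF h D.Hom_source[OF f]] .
  have "f \<cdot>\<^bsub>D\<^esub> h' = Zer D (FOb F W) Y"
    using transpose_eq_Zer_iff[OF W D.Cmp_in_Hom[OF h'(1) f]] transpose_Cmp_left[OF W h'(1) f]
      h'(2) fh by simp
  then obtain u where u: "u \<in> Hom D (FOb F W) K" "k \<cdot>\<^bsub>D\<^esub> u = h'" using ker' h'(1) by blast
  have "FAr G k \<cdot>\<^bsub>C\<^esub> transpose W K u = h"
    using transpose_Cmp_left[OF W u(1) k] u(2) h'(2) by simp
  then show "\<exists>!u. u \<in> Hom C W (FOb G K) \<and> FAr G k \<cdot>\<^bsub>C\<^esub> u = h"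
    using transpose_in_Hom[OF u(1) W] C.monomorphism_cancel[OF
        right_adjoint_preserves_monomorphism[OF k D.kernel_monomorphism[OF ker]] G.FAr_in_Hom[OF k]]
    by metis
qed

lemma left_adjoint_preserves_epimorphism:
  assumes f: "f \<in> Hom C X Y" and epi: "epimorphism C f"
  shows "epimorphism D (FAr F f)"
proof (rule D.epimorphismI[OF F.FAr_in_Hom[OF f]])
  fix Z g h assume g: "g \<in> Hom D (FOb F Y) Z" and h: "h \<in> Hom D (FOb F Y) Z"
    and eq: "g \<cdot>\<^bsub>D\<^esub> FAr F f = h \<cdot>\<^bsub>D\<^esub> FAr F f"
  note Y = C.Hom_target[OF f]
  have "transpose Y Z g \<cdot>\<^bsub>C\<^esub> f = transpose Y Z h \<cdot>\<^bsub>C\<^esub> f"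
    using transpose_Cmp_right[OF f g] transpose_Cmp_right[OF f h] eq by simp
  then have "transpose Y Z g = transpose Y Z h"
    using C.epimorphism_cancel[OF epi f transpose_in_Hom[OF g Y] transpose_in_Hom[OF h Y]] by simp
  then show "g = h" using transpose_inj[OF Y g h] by simp
qed

lemma left_adjoint_preserves_cokernel:
  assumes c: "c \<in> Hom C Y Q" and f: "f \<in> Hom C X Y" and coker: "is_cokernel C c f"
  shows "is_cokernel D (FAr F c) (FAr F f)"
  unfolding D.is_cokernel_iff[OF F.FAr_in_Hom[OF c] F.FAr_in_Hom[OF f]]
proof (intro conjI allI ballI impI)
  note coker' = coker[unfolded C.is_cokernel_iff[OF c f]]
  note X = C.Hom_source[OF f] and Y = C.Hom_target[OF f] and Q = C.Hom_target[OF c]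
  show "FAr F c \<cdot>\<^bsub>D\<^esub> FAr F f = Zer D (FOb F X) (FOb F Q)"
    using coker' F.FAr_Cmp[OF f c] F.FAr_Zer[OF X Q] by simp
  fix Z h assume h: "h \<in> Hom D (FOb F Y) Z" and hf: "h \<cdot>\<^bsub>D\<^esub> FAr F f = Zer D (FOb F X) Z"
  note Z = D.Hom_target[OF h]
  have "transpose Y Z h \<cdot>\<^bsub>C\<^esub> f = Zer C X (FOb G Z)"
    using transpose_Cmp_right[OF f h] hf transpose_Zer[OF X Z] by simp
  then obtain w where w: "w \<in> Hom C Q (FOb G Z)" "w \<cdot>\<^bsub>C\<^esub> c = transpose Y Z h"
    using coker' transpose_in_Hom[OF h Y] by blast
  obtain u where u: "u \<in> Hom D (FOb F Q) Z" "transpose Q Z u = w"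
    using transpose_surj[OF w(1) Z] .
  have "u \<cdot>\<^bsub>D\<^esub> FAr F c = h"
    using transpose_inj[OF Y D.Cmp_in_Hom[OF F.FAr_in_Hom[OF c] u(1)] h]
      transpose_Cmp_right[OF c u(1)] u(2) w(2) by simp
  then show "\<exists>!u. u \<in> Hom D (FOb F Q) Z \<and> u \<cdot>\<^bsub>D\<^esub> FAr F c = h"
    using u(1) D.epimorphism_cancel[OF
        left_adjoint_preserves_epimorphism[OF c C.cokernel_epimorphism[OF coker]] F.FAr_in_Hom[OF c]]
    by metis
qed

lemma left_adjoint_preserves_direct_limit:
  assumes sys: "direct_system C I r X t" and r: "r \<subseteq> I \<times> I" and lim: "is_direct_limit C I r X t L a"
  shows "is_direct_limit D I r (\<lambda>i. FOb F (X i)) (\<lambda>i j. FAr F (t i j)) (FOb F L) (\<lambda>i. FAr F (a i))"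
  unfolding is_direct_limit_def
proof (intro conjI allI impI)
  show "is_cocone D I r (\<lambda>i. FOb F (X i)) (\<lambda>i j. FAr F (t i j)) (FOb F L) (\<lambda>i. FAr F (a i))"
    using F.image_cocone[OF sys r C.direct_limit_cocone[OF lim]] .
  fix Z b assume cocone: "is_cocone D I r (\<lambda>i. FOb F (X i)) (\<lambda>i j. FAr F (t i j)) Z b"
  then have Z: "Z \<in> Ob D" and bH: "\<And>i. i \<in> I \<Longrightarrow> b i \<in> Hom D (FOb F (X i)) Z"
    by (auto simp: is_cocone_def)
  have X: "X i \<in> Ob C" if "i \<in> I" for i using sys that by (simp add: direct_system_def)
  have L: "L \<in> Ob C" using C.direct_limit_cocone[OF lim] by (simp add: is_cocone_def)
  note aH = C.direct_limit_leg[OF lim]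
  have cocone_G: "is_cocone C I r X t (FOb G Z) (\<lambda>i. transpose (X i) Z (b i))"
    unfolding is_cocone_def
  proof (intro conjI ballI allI impI)
    show "FOb G Z \<in> Ob C" using G.FOb_in_Ob[OF Z] .
    show "transpose (X i) Z (b i) \<in> Hom C (X i) (FOb G Z)" if "i \<in> I" for i
      using transpose_in_Hom[OF bH[OF that] X[OF that]] .
    fix i j assume ij: "(i, j) \<in> r"
    then have j: "j \<in> I" and t: "t i j \<in> Hom C (X i) (X j)"
      using r sys by (auto simp: direct_system_def)
    show "transpose (X j) Z (b j) \<cdot>\<^bsub>C\<^esub> t i j = transpose (X i) Z (b i)"
      using transpose_Cmp_right[OF t bH[OF j]] cocone ij by (simp add: is_cocone_def)
  qed
  obtain w where w: "w \<in> Hom C L (FOb G Z)"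
      "\<And>i. i \<in> I \<Longrightarrow> w \<cdot>\<^bsub>C\<^esub> a i = transpose (X i) Z (b i)"
    using C.direct_limit_desc[OF lim cocone_G] by metis
  obtain u where u: "u \<in> Hom D (FOb F L) Z" "transpose L Z u = w"
    using transpose_surj[OF w(1) Z] .
  show "\<exists>!u. u \<in> Hom D (FOb F L) Z \<and> (\<forall>i\<in>I. u \<cdot>\<^bsub>D\<^esub> FAr F (a i) = b i)"
  proof (intro ex1I conjI ballI)
    show "u \<in> Hom D (FOb F L) Z" using u(1) .
    show "u \<cdot>\<^bsub>D\<^esub> FAr F (a i) = b i" if i: "i \<in> I" for i
      using transpose_inj[OF X[OF i] D.Cmp_in_Hom[OF F.FAr_in_Hom[OF aH[OF i]] u(1)] bH[OF i]]
        transpose_Cmp_right[OF aH[OF i] u(1)] u(2) w(2)[OF i] by simp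
    fix v assume v: "v \<in> Hom D (FOb F L) Z \<and> (\<forall>i\<in>I. v \<cdot>\<^bsub>D\<^esub> FAr F (a i) = b i)"
    then have vH: "v \<in> Hom D (FOb F L) Z" by simp
    have "transpose L Z v = w"
    proof (rule C.direct_limit_hom_ext[OF lim sys r transpose_in_Hom[OF vH L] w(1)])
      fix i assume i: "i \<in> I"
      show "transpose L Z v \<cdot>\<^bsub>C\<^esub> a i = w \<cdot>\<^bsub>C\<^esub> a i"
        using transpose_Cmp_right[OF aH[OF i] vH] v i w(2)[OF i] by simp
    qed
    then show "v = u" using transpose_inj[OF L vH u(1)] u(2) by simp
  qed
qed

end


section \<open>Reflective subcategories\<close>

locale reflection = additive_adjunction C D F G
  for C :: "('o, 'm, 'y) preadditive_data_scheme"
    and D :: "('p, 'n, 'z) preadditive_data_scheme"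
    and F :: "('o, 'm, 'p, 'n) functor_data"
    and G :: "('p, 'n, 'o, 'm) functor_data" +
  assumes right_adjoint_fully_faithful: "fully_faithful D C G"
begin

sublocale G: fully_faithful_functor D C G
  by unfold_locales (rule right_adjoint_fully_faithful)

text \<open>
  A morphism \<open>F G\<^sub>0 \<rightarrow> M\<close> detects that \<open>\<phi>\<close> is nonzero as soon as its transpose \<open>G\<^sub>0 \<rightarrow> G M\<close> detects
  that \<open>G \<phi>\<close> is nonzero.
\<close>

lemma reflection_generator:
  assumes "is_generator C G0"
  shows "is_generator D (FOb F G0)"
  unfolding is_generator_def
proof (intro conjI ballI impI)
  have G0: "G0 \<in> Ob C" using assms by (simp add: is_generator_def)
  show "FOb F G0 \<in> Ob D" using F.FOb_in_Ob[OF G0] .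
  fix M N f assume "M \<in> Ob D" "N \<in> Ob D" and f: "f \<in> Hom D M N" and "f \<noteq> Zer D M N"
  then have "FAr G f \<noteq> Zer C (FOb G M) (FOb G N)" using G.FAr_eq_Zer_iff[OF f] by simp
  then obtain h where h: "h \<in> Hom C G0 (FOb G M)" "FAr G f \<cdot>\<^bsub>C\<^esub> h \<noteq> Zer C G0 (FOb G N)"
    using assms G.FAr_in_Hom[OF f] C.Hom_source C.Hom_target unfolding is_generator_def by metis
  obtain k where k: "k \<in> Hom D (FOb F G0) M" "transpose G0 M k = h"
    using transpose_surj[OF h(1) \<open>M \<in> Ob D\<close>] .
  have "f \<cdot>\<^bsub>D\<^esub> k \<noteq> Zer D (FOb F G0) N"
    using h(2) transpose_Cmp_left[OF G0 k(1) f] k(2)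
      transpose_eq_Zer_iff[OF G0 D.Cmp_in_Hom[OF k(1) f]] by simp
  then show "\<exists>h\<in>Hom D (FOb F G0) M. f \<cdot>\<^bsub>D\<^esub> h \<noteq> Zer D (FOb F G0) N" using k(1) by blast
qed

text \<open>
  The morphism \<open>Z \<rightarrow> F M\<close> that corresponds to \<open>a : G Z \<rightarrow> M\<close>: compose \<open>a\<close> with the unit \<open>M \<rightarrow> G F M\<close>
  and use that \<open>G\<close> is full. Applied to the legs \<open>G X\<^sub>i \<rightarrow> M\<close> of a colimit cocone in \<open>C\<close>, it gives the legs
  \<open>X\<^sub>i \<rightarrow> F M\<close> of a colimit cocone in \<open>D\<close>. The unit is written as the transpose of the identity of \<open>F M\<close>.
\<close>

definition reflected_leg :: "'p \<Rightarrow> 'o \<Rightarrow> 'm \<Rightarrow> 'n" where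
  "reflected_leg Z M a = (SOME b. b \<in> Hom D Z (FOb F M) \<and>
     FAr G b = transpose M (FOb F M) (Idn D (FOb F M)) \<cdot>\<^bsub>C\<^esub> a)"

lemma
  assumes "Z \<in> Ob D" and a: "a \<in> Hom C (FOb G Z) M"
  shows reflected_leg_in_Hom: "reflected_leg Z M a \<in> Hom D Z (FOb F M)"
    and FAr_reflected_leg:
      "FAr G (reflected_leg Z M a) = transpose M (FOb F M) (Idn D (FOb F M)) \<cdot>\<^bsub>C\<^esub> a"
proof -
  note M = C.Hom_target[OF a]
  note FM = F.FOb_in_Ob[OF M]
  have "transpose M (FOb F M) (Idn D (FOb F M)) \<cdot>\<^bsub>C\<^esub> a \<in> Hom C (FOb G Z) (FOb G (FOb F M))"
    using C.Cmp_in_Hom[OF a transpose_in_Hom[OF D.Idn_in_Hom[OF FM] M]] .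
  then have "\<exists>b. b \<in> Hom D Z (FOb F M) \<and>
      FAr G b = transpose M (FOb F M) (Idn D (FOb F M)) \<cdot>\<^bsub>C\<^esub> a"
    using G.FAr_surj[OF assms(1) FM] by metis
  from someI_ex[OF this]
  show "reflected_leg Z M a \<in> Hom D Z (FOb F M)"
    and "FAr G (reflected_leg Z M a) = transpose M (FOb F M) (Idn D (FOb F M)) \<cdot>\<^bsub>C\<^esub> a"
    by (auto simp: reflected_leg_def)
qed

text \<open>
  This equivalence transfers universal properties: the morphisms \<open>u : F M \<rightarrow> N\<close> that extend a given
  family along the reflected legs correspond, by transposition, to the morphisms \<open>M \<rightarrow> G N\<close> that extend
  the \<open>G\<close>-image of the family along the original legs.
\<close>

lemma Cmp_reflected_leg_eq_iff:
  assumes Z: "Z \<in> Ob D" and a: "a \<in> Hom C (FOb G Z) M"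
    and u: "u \<in> Hom D (FOb F M) N" and h: "h \<in> Hom D Z N"
  shows "u \<cdot>\<^bsub>D\<^esub> reflected_leg Z M a = h \<longleftrightarrow> transpose M N u \<cdot>\<^bsub>C\<^esub> a = FAr G h"
proof -
  note M = C.Hom_target[OF a]
  note id = D.Idn_in_Hom[OF F.FOb_in_Ob[OF M]]
  note b = reflected_leg_in_Hom[OF Z a]
  have "FAr G (u \<cdot>\<^bsub>D\<^esub> reflected_leg Z M a)
      = FAr G u \<cdot>\<^bsub>C\<^esub> transpose M (FOb F M) (Idn D (FOb F M)) \<cdot>\<^bsub>C\<^esub> a"
    using G.FAr_Cmp[OF b u] FAr_reflected_leg[OF Z a]
      C.Cmp_assoc[OF a transpose_in_Hom[OF id M] G.FAr_in_Hom[OF u]] by simp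
  also have "\<dots> = transpose M N u \<cdot>\<^bsub>C\<^esub> a"
    using transpose_Cmp_left[OF M id u] D.Cmp_Idn_right[OF u] by simp
  finally have "FAr G (u \<cdot>\<^bsub>D\<^esub> reflected_leg Z M a) = transpose M N u \<cdot>\<^bsub>C\<^esub> a" .
  then show ?thesis using G.FAr_inj[OF D.Cmp_in_Hom[OF b u] h] by auto
qed

lemma reflected_leg_natural:
  assumes f: "f \<in> Hom D Z Z'" and a: "a \<in> Hom C (FOb G Z) M" and a': "a' \<in> Hom C (FOb G Z') M'"
    and w: "w \<in> Hom C M M'" and eq: "w \<cdot>\<^bsub>C\<^esub> a = a' \<cdot>\<^bsub>C\<^esub> FAr G f"
  shows "FAr F w \<cdot>\<^bsub>D\<^esub> reflected_leg Z M a = reflected_leg Z' M' a' \<cdot>\<^bsub>D\<^esub> f"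
proof -
  let ?\<eta> = "transpose M' (FOb F M') (Idn D (FOb F M'))"
  note Z = D.Hom_source[OF f] and Z' = D.Hom_target[OF f] and M' = C.Hom_target[OF w]
  note id = D.Idn_in_Hom[OF F.FOb_in_Ob[OF M']]
  note b' = reflected_leg_in_Hom[OF Z' a'] and \<eta> = transpose_in_Hom[OF id M']
  have "transpose M (FOb F M') (FAr F w) \<cdot>\<^bsub>C\<^esub> a = ?\<eta> \<cdot>\<^bsub>C\<^esub> w \<cdot>\<^bsub>C\<^esub> a"
    using transpose_Cmp_right[OF w id] D.Cmp_Idn_left[OF F.FAr_in_Hom[OF w]] by simp
  also have "\<dots> = ?\<eta> \<cdot>\<^bsub>C\<^esub> a' \<cdot>\<^bsub>C\<^esub> FAr G f"
    using C.Cmp_assoc[OF a w \<eta>] eq C.Cmp_assoc[OF G.FAr_in_Hom[OF f] a' \<eta>] by simp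
  also have "\<dots> = FAr G (reflected_leg Z' M' a' \<cdot>\<^bsub>D\<^esub> f)"
    using FAr_reflected_leg[OF Z' a'] G.FAr_Cmp[OF f b'] by simp
  finally show ?thesis
    using Cmp_reflected_leg_eq_iff[OF Z a F.FAr_in_Hom[OF w] D.Cmp_in_Hom[OF f b']] by simp
qed

lemma reflection_coproduct:
  assumes X: "\<And>i. i \<in> I \<Longrightarrow> X i \<in> Ob D" and P: "is_coproduct C I (\<lambda>i. FOb G (X i)) P \<iota>"
  shows "is_coproduct D I X (FOb F P) (\<lambda>i. reflected_leg (X i) P (\<iota> i))"
  unfolding is_coproduct_def
proof (intro conjI ballI allI impI)
  have Pob: "P \<in> Ob C" and \<iota>: "\<And>i. i \<in> I \<Longrightarrow> \<iota> i \<in> Hom C (FOb G (X i)) P"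
    using P by (auto simp: is_coproduct_def)
  show "FOb F P \<in> Ob D" using F.FOb_in_Ob[OF Pob] .
  show "reflected_leg (X i) P (\<iota> i) \<in> Hom D (X i) (FOb F P)" if "i \<in> I" for i
    using reflected_leg_in_Hom[OF X \<iota>] that by blast
  fix Z f assume Z: "Z \<in> Ob D" and f: "\<forall>i\<in>I. f i \<in> Hom D (X i) Z"
  then have "\<forall>i\<in>I. FAr G (f i) \<in> Hom C (FOb G (X i)) (FOb G Z)"
    using G.FAr_in_Hom by blast
  then have ex: "\<exists>!w. w \<in> Hom C P (FOb G Z) \<and> (\<forall>i\<in>I. w \<cdot>\<^bsub>C\<^esub> \<iota> i = FAr G (f i))"
    using P[unfolded is_coproduct_def, THEN conjunct2, THEN conjunct2, rule_format,
        of "FOb G Z" "\<lambda>i. FAr G (f i)"] G.FOb_in_Ob[OF Z] by blast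
  then obtain w where w: "w \<in> Hom C P (FOb G Z)" "\<forall>i\<in>I. w \<cdot>\<^bsub>C\<^esub> \<iota> i = FAr G (f i)" by blast
  obtain u where u: "u \<in> Hom D (FOb F P) Z" "transpose P Z u = w"
    using transpose_surj[OF w(1) Z] .
  have iff: "v \<cdot>\<^bsub>D\<^esub> reflected_leg (X i) P (\<iota> i) = f i \<longleftrightarrow> transpose P Z v \<cdot>\<^bsub>C\<^esub> \<iota> i = FAr G (f i)"
    if "v \<in> Hom D (FOb F P) Z" "i \<in> I" for v i
    using Cmp_reflected_leg_eq_iff[OF X[OF that(2)] \<iota>[OF that(2)] that(1)] f that(2) by blast
  show "\<exists>!u. u \<in> Hom D (FOb F P) Z \<and> (\<forall>i\<in>I. u \<cdot>\<^bsub>D\<^esub> reflected_leg (X i) P (\<iota> i) = f i)"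
  proof (intro ex1I conjI)
    show "u \<in> Hom D (FOb F P) Z" using u(1) .
    show "\<forall>i\<in>I. u \<cdot>\<^bsub>D\<^esub> reflected_leg (X i) P (\<iota> i) = f i" using iff[OF u(1)] u(2) w(2) by simp
    fix v assume v: "v \<in> Hom D (FOb F P) Z \<and>
      (\<forall>i\<in>I. v \<cdot>\<^bsub>D\<^esub> reflected_leg (X i) P (\<iota> i) = f i)"
    then have "transpose P Z v \<in> Hom C P (FOb G Z) \<and>
        (\<forall>i\<in>I. transpose P Z v \<cdot>\<^bsub>C\<^esub> \<iota> i = FAr G (f i))"
      using iff transpose_in_Hom[OF _ Pob] by blast
    then have "transpose P Z v = transpose P Z u" using ex w u(2) by metis
    then show "v = u" using transpose_inj[OF Pob] v u(1) by blast
  qed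
qed

lemma reflection_direct_limit:
  assumes sys: "direct_system D I r X t" and r: "r \<subseteq> I \<times> I"
    and lim: "is_direct_limit C I r (\<lambda>i. FOb G (X i)) (\<lambda>i j. FAr G (t i j)) M a"
  shows "is_direct_limit D I r X t (FOb F M) (\<lambda>i. reflected_leg (X i) M (a i))"
  unfolding is_direct_limit_def
proof (intro conjI allI impI)
  let ?b = "\<lambda>i. reflected_leg (X i) M (a i)"
  have X: "X i \<in> Ob D" if "i \<in> I" for i using sys that by (simp add: direct_system_def)
  note aH = C.direct_limit_leg[OF lim]
  have M: "M \<in> Ob C" using C.direct_limit_cocone[OF lim] by (simp add: is_cocone_def)
  note id = C.Idn_in_Hom[OF M]
  have bH: "?b i \<in> Hom D (X i) (FOb F M)" if "i \<in> I" for i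
    using reflected_leg_in_Hom[OF X[OF that] aH[OF that]] .
  show "is_cocone D I r X t (FOb F M) ?b"
    unfolding is_cocone_def
  proof (intro conjI ballI allI impI)
    show "FOb F M \<in> Ob D" using F.FOb_in_Ob[OF M] .
    show "?b i \<in> Hom D (X i) (FOb F M)" if "i \<in> I" for i using bH[OF that] .
    fix i j assume ij: "(i, j) \<in> r"
    then have i: "i \<in> I" and j: "j \<in> I" and t: "t i j \<in> Hom D (X i) (X j)"
      using r sys by (auto simp: direct_system_def)
    \<comment> \<open>Compatibility of the legs is naturality along the identity of \<open>M\<close>.\<close>
    have "Idn C M \<cdot>\<^bsub>C\<^esub> a i = a j \<cdot>\<^bsub>C\<^esub> FAr G (t i j)"
      using C.Cmp_Idn_left[OF aH[OF i]] C.direct_limit_cocone[OF lim] ij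
      by (simp add: is_cocone_def)
    then have "FAr F (Idn C M) \<cdot>\<^bsub>D\<^esub> ?b i = ?b j \<cdot>\<^bsub>D\<^esub> t i j"
      by (rule reflected_leg_natural[OF t aH[OF i] aH[OF j] id])
    then show "?b j \<cdot>\<^bsub>D\<^esub> t i j = ?b i"
      using F.FAr_Idn[OF M] D.Cmp_Idn_left[OF bH[OF i]] by simp
  qed
  fix Z f assume cocone: "is_cocone D I r X t Z f"
  then have Z: "Z \<in> Ob D" and f: "\<And>i. i \<in> I \<Longrightarrow> f i \<in> Hom D (X i) Z"
    by (auto simp: is_cocone_def)
  have ex: "\<exists>!w. w \<in> Hom C M (FOb G Z) \<and> (\<forall>i\<in>I. w \<cdot>\<^bsub>C\<^esub> a i = FAr G (f i))"
    using lim G.image_cocone[OF sys r cocone] by (simp add: is_direct_limit_def)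
  then obtain w where w: "w \<in> Hom C M (FOb G Z)" "\<forall>i\<in>I. w \<cdot>\<^bsub>C\<^esub> a i = FAr G (f i)" by blast
  obtain u where u: "u \<in> Hom D (FOb F M) Z" "transpose M Z u = w"
    using transpose_surj[OF w(1) Z] .
  have iff: "v \<cdot>\<^bsub>D\<^esub> ?b i = f i \<longleftrightarrow> transpose M Z v \<cdot>\<^bsub>C\<^esub> a i = FAr G (f i)"
    if "v \<in> Hom D (FOb F M) Z" "i \<in> I" for v i
    using Cmp_reflected_leg_eq_iff[OF X[OF that(2)] aH[OF that(2)] that(1) f[OF that(2)]] .
  show "\<exists>!u. u \<in> Hom D (FOb F M) Z \<and> (\<forall>i\<in>I. u \<cdot>\<^bsub>D\<^esub> ?b i = f i)"
  proof (intro ex1I conjI)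
    show "u \<in> Hom D (FOb F M) Z" using u(1) .
    show "\<forall>i\<in>I. u \<cdot>\<^bsub>D\<^esub> ?b i = f i" using iff[OF u(1)] u(2) w(2) by simp
    fix v assume v: "v \<in> Hom D (FOb F M) Z \<and> (\<forall>i\<in>I. v \<cdot>\<^bsub>D\<^esub> ?b i = f i)"
    then have "transpose M Z v \<in> Hom C M (FOb G Z) \<and>
        (\<forall>i\<in>I. transpose M Z v \<cdot>\<^bsub>C\<^esub> a i = FAr G (f i))"
      using iff transpose_in_Hom[OF _ M] by blast
    then have "transpose M Z v = transpose M Z u" using ex w u(2) by metis
    then show "v = u" using transpose_inj[OF M] v u(1) by blast
  qed
qed

lemma reflection_has_small_coproducts:
  fixes \<kappa> :: "'k rel"
  assumes "has_small_coproducts \<kappa> C"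
  shows "has_small_coproducts \<kappa> D"
  unfolding has_small_coproducts_def
proof (intro allI impI, elim conjE)
  fix I :: "'k set" and X
  assume I: "small \<kappa> I" and X: "\<forall>i\<in>I. X i \<in> Ob D"
  then have "\<forall>i\<in>I. FOb G (X i) \<in> Ob C" using G.FOb_in_Ob by blast
  then obtain P \<iota> where P: "is_coproduct C I (\<lambda>i. FOb G (X i)) P \<iota>"
    using assms[unfolded has_small_coproducts_def, rule_format, of I "\<lambda>i. FOb G (X i)"] I by blast
  have "is_coproduct D I X (FOb F P) (\<lambda>i. reflected_leg (X i) P (\<iota> i))"
    by (rule reflection_coproduct[OF _ P]) (use X in simp)
  then show "\<exists>P \<iota>. is_coproduct D I X P \<iota>" by (intro exI)
qed

lemma reflection_direct_limit_exists:
  fixes \<kappa> :: "'k rel" and I :: "'k set"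
  assumes "has_exact_direct_limits \<kappa> C" "small \<kappa> I" "directed_set I r" "direct_system D I r X t"
  shows "\<exists>L a. is_direct_limit D I r X t L a"
proof -
  have r: "r \<subseteq> I \<times> I" using assms(3) by (simp add: directed_set_def preorder_on_def)
  obtain M a where "is_direct_limit C I r (\<lambda>i. FOb G (X i)) (\<lambda>i j. FAr G (t i j)) M a"
    using direct_limit_exists[OF assms(1-3) G.image_direct_system[OF assms(4)]] .
  from reflection_direct_limit[OF assms(4) r this] show ?thesis by (intro exI)
qed

text \<open>
  The functor \<open>G\<close> is left exact but need not be right exact, so the hypothesis on \<open>C\<close> cannot be
  applied to the \<open>G\<close>-images of short exact sequences. However, only the preservation of monomorphisms
  is in question, and \<open>G\<close> preserves these. A direct limit of monomorphisms in \<open>D\<close> is, up to isomorphism,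
  the image under \<open>F\<close> of a direct limit of their \<open>G\<close>-images in \<open>C\<close>.
\<close>

lemma reflection_has_exact_direct_limits:
  fixes \<kappa> :: "'k rel"
  assumes ab: "abelian_category C" "abelian_category D" and exact: "has_exact_direct_limits \<kappa> C"
    and F_mono: "\<And>M N w. \<lbrakk>w \<in> Hom C M N; monomorphism C w\<rbrakk> \<Longrightarrow> monomorphism D (FAr F w)"
  shows "has_exact_direct_limits \<kappa> D"
proof (rule has_exact_direct_limitsI)
  fix I :: "'k set" and r X t
  assume "small \<kappa> I" "directed_set I r" "direct_system D I r X t"
  then show "\<exists>L a. is_direct_limit D I r X t L a"
    by (rule reflection_direct_limit_exists[OF exact])
next
  fix I :: "'k set" and r X t X' t' X'' t'' f g L a L' a' L'' a'' u v
  assume I: "small \<kappa> I" "directed_set I r"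
    and sys: "direct_system D I r X t" "direct_system D I r X' t'" "direct_system D I r X'' t''"
    and f: "direct_system_map D I r X t X' t' f" and g: "direct_system_map D I r X' t' X'' t'' g"
    and ses: "\<And>i. i \<in> I \<Longrightarrow> short_exact D (f i) (g i)"
    and lim: "is_direct_limit D I r X t L a" "is_direct_limit D I r X' t' L' a'"
      "is_direct_limit D I r X'' t'' L'' a''"
    and u: "u \<in> Hom D L L'" "\<And>i. i \<in> I \<Longrightarrow> u \<cdot>\<^bsub>D\<^esub> a i = a' i \<cdot>\<^bsub>D\<^esub> f i"
    and v: "v \<in> Hom D L' L''" "\<And>i. i \<in> I \<Longrightarrow> v \<cdot>\<^bsub>D\<^esub> a' i = a'' i \<cdot>\<^bsub>D\<^esub> g i"
  interpret CA: abelian_category C by (rule ab(1))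
  interpret DA: abelian_category D by (rule ab(2))
  have r: "r \<subseteq> I \<times> I" using I(2) by (simp add: directed_set_def preorder_on_def)
  have fH: "f i \<in> Hom D (X i) (X' i)" if "i \<in> I" for i
    using f that by (simp add: direct_system_map_def)
  have ker: "is_kernel D (f i) (g i)" and coker: "is_cokernel D (g i) (f i)" if "i \<in> I" for i
    using ses[OF that] by (auto simp: short_exact_def)
  note Gsys = G.image_direct_system[OF sys(1)] G.image_direct_system[OF sys(2)]
  note Gf = G.image_direct_system_map[OF sys(1,2) r f]
  obtain M b where M: "is_direct_limit C I r (\<lambda>i. FOb G (X i)) (\<lambda>i j. FAr G (t i j)) M b"
    using direct_limit_exists[OF exact I Gsys(1)] .
  obtain M' b' where M': "is_direct_limit C I r (\<lambda>i. FOb G (X' i)) (\<lambda>i j. FAr G (t' i j)) M' b'"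
    using direct_limit_exists[OF exact I Gsys(2)] .
  obtain w where w: "w \<in> Hom C M M'" "\<And>i. i \<in> I \<Longrightarrow> w \<cdot>\<^bsub>C\<^esub> b i = b' i \<cdot>\<^bsub>C\<^esub> FAr G (f i)"
    using C.direct_limit_desc[OF M C.cocone_precompose_map[OF Gsys r Gf C.direct_limit_cocone[OF M']]]
    by metis
  have "monomorphism C (FAr G (f i))" if "i \<in> I" for i
    using right_adjoint_preserves_monomorphism[OF fH[OF that] D.kernel_monomorphism[OF ker[OF that]]] .
  then have "monomorphism C w"
    by (rule CA.monomorphism_direct_limit[OF exact I Gsys Gf _ M M' w])
  then have Fw: "monomorphism D (FAr F w)" by (rule F_mono[OF w(1)])
  have "FAr F w \<cdot>\<^bsub>D\<^esub> reflected_leg (X i) M (b i) = reflected_leg (X' i) M' (b' i) \<cdot>\<^bsub>D\<^esub> f i"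
    if i: "i \<in> I" for i
    using reflected_leg_natural[OF fH[OF i] C.direct_limit_leg[OF M i] C.direct_limit_leg[OF M' i]
        w(1) w(2)[OF i]] .
  then have "monomorphism D u"
    using D.monomorphism_between_direct_limits[OF sys(1,2) r f lim(1,2)
        reflection_direct_limit[OF sys(1) r M] reflection_direct_limit[OF sys(2) r M']
        u F.FAr_in_Hom[OF w(1)] _ Fw] by blast
  moreover have "is_cokernel D v u"
    by (rule D.cokernel_direct_limit[OF sys r f g coker lim u v])
  ultimately show "short_exact D u v" by (rule DA.short_exact_if_monomorphism)
qed

text \<open>
  If the inclusion \<open>G\<close> has a right adjoint as well, then it preserves kernels, cokernels and direct
  limits, so exactness can be tested after applying it.
\<close>

lemma bireflection_has_exact_direct_limits:
  fixes \<kappa> :: "'k rel"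
  assumes "additive_adjunction D C G H" and exact: "has_exact_direct_limits \<kappa> C"
  shows "has_exact_direct_limits \<kappa> D"
proof (rule has_exact_direct_limitsI)
  fix I :: "'k set" and r X t
  assume "small \<kappa> I" "directed_set I r" "direct_system D I r X t"
  then show "\<exists>L a. is_direct_limit D I r X t L a"
    by (rule reflection_direct_limit_exists[OF exact])
next
  fix I :: "'k set" and r X t X' t' X'' t'' f g L a L' a' L'' a'' u v
  assume I: "small \<kappa> I" "directed_set I r"
    and sys: "direct_system D I r X t" "direct_system D I r X' t'" "direct_system D I r X'' t''"
    and f: "direct_system_map D I r X t X' t' f" and g: "direct_system_map D I r X' t' X'' t'' g"
    and ses: "\<And>i. i \<in> I \<Longrightarrow> short_exact D (f i) (g i)"
    and lim: "is_direct_limit D I r X t L a" "is_direct_limit D I r X' t' L' a'"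
      "is_direct_limit D I r X'' t'' L'' a''"
    and u: "u \<in> Hom D L L'" "\<And>i. i \<in> I \<Longrightarrow> u \<cdot>\<^bsub>D\<^esub> a i = a' i \<cdot>\<^bsub>D\<^esub> f i"
    and v: "v \<in> Hom D L' L''" "\<And>i. i \<in> I \<Longrightarrow> v \<cdot>\<^bsub>D\<^esub> a' i = a'' i \<cdot>\<^bsub>D\<^esub> g i"
  interpret GH: additive_adjunction D C G H by (rule assms(1))
  have r: "r \<subseteq> I \<times> I" using I(2) by (simp add: directed_set_def preorder_on_def)
  have fH: "f i \<in> Hom D (X i) (X' i)" and gH: "g i \<in> Hom D (X' i) (X'' i)" if "i \<in> I" for i
    using f g that by (auto simp: direct_system_map_def)
  have G_ses: "short_exact C (FAr G (f i)) (FAr G (g i))" if "i \<in> I" for i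
    using ses[OF that] right_adjoint_preserves_kernel[OF fH[OF that] gH[OF that]]
      GH.left_adjoint_preserves_cokernel[OF gH[OF that] fH[OF that]]
    by (simp add: short_exact_def)
  have G_u: "FAr G u \<cdot>\<^bsub>C\<^esub> FAr G (a i) = FAr G (a' i) \<cdot>\<^bsub>C\<^esub> FAr G (f i)" if i: "i \<in> I" for i
    using G.FAr_Cmp[OF D.direct_limit_leg[OF lim(1) i] u(1)] u(2)[OF i]
      G.FAr_Cmp[OF fH[OF i] D.direct_limit_leg[OF lim(2) i]] by simp
  have G_v: "FAr G v \<cdot>\<^bsub>C\<^esub> FAr G (a' i) = FAr G (a'' i) \<cdot>\<^bsub>C\<^esub> FAr G (g i)" if i: "i \<in> I" for i
    using G.FAr_Cmp[OF D.direct_limit_leg[OF lim(2) i] v(1)] v(2)[OF i]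
      G.FAr_Cmp[OF gH[OF i] D.direct_limit_leg[OF lim(3) i]] by simp
  have "short_exact C (FAr G u) (FAr G v)"
    by (rule direct_limit_short_exact[OF exact I
          G.image_direct_system[OF sys(1)] G.image_direct_system[OF sys(2)]
          G.image_direct_system[OF sys(3)] G.image_direct_system_map[OF sys(1,2) r f]
          G.image_direct_system_map[OF sys(2,3) r g] G_ses
          GH.left_adjoint_preserves_direct_limit[OF sys(1) r lim(1)]
          GH.left_adjoint_preserves_direct_limit[OF sys(2) r lim(2)]
          GH.left_adjoint_preserves_direct_limit[OF sys(3) r lim(3)]
          G.FAr_in_Hom[OF u(1)] G_u G.FAr_in_Hom[OF v(1)] G_v])
  then show "short_exact D u v"
    using G.reflects_kernel[OF u(1) v(1)] G.reflects_cokernel[OF v(1) u(1)]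
    by (simp add: short_exact_def)
qed

end


section \<open>Recollements\<close>

lemma additive_adjunctionI:
  assumes "abelian_category C" "abelian_category D" "additive_functor C D F" "additive_functor D C G"
    and "adjunction C D F G"
  shows "additive_adjunction C D F G"
  using assms
  by (intro additive_adjunction.intro functor_between_preadditive.intro
      additive_adjunction_axioms.intro abelian_category.axioms(1))

theorem lemma4p1:
  fixes \<kappa> :: "'k rel"
    and A :: "('a, 'am, 'az) preadditive_data_scheme"
    and Y :: "('y, 'ym, 'yz) preadditive_data_scheme"
    and X :: "('x, 'xm, 'xz) preadditive_data_scheme"
    and i_lower_star :: "('y, 'ym, 'a, 'am) functor_data"
    and i_upper_star i_upper_shriek :: "('a, 'am, 'y, 'ym) functor_data"
    and j_upper_star :: "('a, 'am, 'x, 'xm) functor_data"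
    and j_lower_shriek j_lower_star :: "('x, 'xm, 'a, 'am) functor_data"
  assumes "Cinfinite \<kappa>"
    and "abelian_category A" "abelian_category X" "abelian_category Y"
    and "locally_small \<kappa> A" "locally_small \<kappa> X" "locally_small \<kappa> Y"
    and "Ext1_small \<kappa> A" "Ext1_small \<kappa> X" "Ext1_small \<kappa> Y"
    and "recollement A Y X i_lower_star i_upper_star i_upper_shriek
           j_upper_star j_lower_shriek j_lower_star"
    and "has_generator A"
  shows "has_generator X \<and> has_generator Y \<and>
    (grothendieck_category \<kappa> A \<longrightarrow> grothendieck_category \<kappa> X \<and> grothendieck_category \<kappa> Y)"
proof -
  interpret recollement A Y X i_lower_star i_upper_star i_upper_shriek
      j_upper_star j_lower_shriek j_lower_star
    by (rule assms(11))
  interpret j: reflection A X j_upper_star j_lower_star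
    using additive_adjunctionI[OF assms(2,3) j_upper_star_additive j_lower_star_additive
        j_lower_star_adjunction] j_lower_star_fully_faithful
    by (intro reflection.intro reflection_axioms.intro)
  interpret i: reflection A Y i_upper_star i_lower_star
    using additive_adjunctionI[OF assms(2,4) i_upper_star_additive i_lower_star_additive
        i_upper_star_adjunction] i_lower_star_fully_faithful
    by (intro reflection.intro reflection_axioms.intro)
  \<comment> \<open>It makes \<open>j\<^sup>*\<close> a right adjoint, which is why \<open>j\<^sup>*\<close> preserves monomorphisms.\<close>
  interpret j': additive_adjunction X A j_lower_shriek j_upper_star
    by (rule additive_adjunctionI[OF assms(3,2) j_lower_shriek_additive j_upper_star_additive
          j_lower_shriek_adjunction])
  have i': "additive_adjunction Y A i_lower_star i_upper_shriek"
    by (rule additive_adjunctionI[OF assms(4,2) i_lower_star_additive i_upper_shriek_additive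
          i_upper_shriek_adjunction])
  have generators: "has_generator X" "has_generator Y"
    using assms(12) j.reflection_generator i.reflection_generator
    unfolding has_generator_def by blast+
  moreover have "grothendieck_category \<kappa> X \<and> grothendieck_category \<kappa> Y"
    if "grothendieck_category \<kappa> A"
  proof -
    have coproducts: "has_small_coproducts \<kappa> A" and exact: "has_exact_direct_limits \<kappa> A"
      using that by (auto simp: grothendieck_category_def)
    have "has_exact_direct_limits \<kappa> X"
      using j.reflection_has_exact_direct_limits[OF assms(2,3) exact
          j'.right_adjoint_preserves_monomorphism] .
    moreover have "has_exact_direct_limits \<kappa> Y"
      using i.bireflection_has_exact_direct_limits[OF i' exact] .
    ultimately show ?thesis
      using assms(3,4) generators j.reflection_has_small_coproducts[OF coproducts]
        i.reflection_has_small_coproducts[OF coproducts]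
      by (simp add: grothendieck_category_def)
  qed
  ultimately show ?thesis by blast
qed

end
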